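(* Let $\mathbb{K}$ be a field, $n\in\{6,7,8\}$, and let $\theta$ be a non-trivial oppomorphism of the building $\mathsf{E}_n(\mathbb{K})$ which is a polar $\{1,2'\}$-kangaroo. (i) If $n=6$, then $\theta$ is either anisotropic or domestic. (ii) If $n\in\{7,8\}$, then $\theta$ is either anisotropic, or $\theta$ is domestic and fixes no chamber.
   Context: An oppomorphism is an automorphism mapping each vertex to a vertex of the opposite type (for $\mathsf{E}_7,\mathsf{E}_8$ this means type preserving; for $\mathsf{E}_6$ it means inducing the non-trivial diagram automorphism). An automorphism is anisotropic if every chamber is mapped to an opposite chamber, and domestic if no chamber is mapped to an opposite chamber. The long root subgroup geometry of $\mathsf{E}_n(\mathbb{K})$ is $\mathsf{E}_{6,2}(\mathbb{K})$, $\mathsf{E}_{7,1}(\mathbb{K})$, $\mathsf{E}_{8,8}(\mathbb{K})$ respectively (points = vertices of type $2,1,8$, Bourbaki labelling). For two of its points the mutual position is $0$ if equal, $1$ if distinct and collinear, $2$ if non-collinear but in a common symplecton (convex subspace isomorphic to a polar space), $2'$ if non-collinear with a unique common neighbour, $3$ if opposite. $\theta$ is a polar $\{1,2'\}$-kangaroo if no point $x$ has $x^\theta$ at mutual position $1$ or $2'$ from $x$. *)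

theory Defs
  imports Main
begin

(* Coxeter system of type E_n (n = 6,7,8), Bourbaki labelling of the nodes 1..n:
   1 - 3 - 4 - 5 - 6 - 7 - 8  with node 2 attached to node 4.
   W is realised faithfully as the reflection group acting on the root lattice,
   vectors written in the basis of simple roots (coordinates indexed by nat;
   only coordinates 1..n are relevant, the others are left untouched). *)

definition E_edge :: "nat \<Rightarrow> nat \<Rightarrow> bool" where
  "E_edge i j \<longleftrightarrow> {i, j} \<in> {{1,3},{3,4},{4,5},{5,6},{6,7},{7,8},{2,4}}"

definition cartan :: "nat \<Rightarrow> nat \<Rightarrow> int" where
  "cartan i j = (if i = j then 2 else if E_edge i j then -1 else 0)"

type_synonym weyl = "(nat \<Rightarrow> int) \<Rightarrow> (nat \<Rightarrow> int)"

definition refl :: "nat \<Rightarrow> nat \<Rightarrow> weyl" where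
  "refl n i v = v(i := v i - (\<Sum>j\<in>{1..n}. cartan i j * v j))"

fun act :: "nat \<Rightarrow> nat list \<Rightarrow> weyl" where
  "act n [] = id"
| "act n (i # w) = refl n i \<circ> act n w"

definition Wsub :: "nat \<Rightarrow> nat set \<Rightarrow> weyl set" where
  "Wsub n J = {act n w | w. set w \<subseteq> J}"

abbreviation W :: "nat \<Rightarrow> weyl set" where
  "W n \<equiv> Wsub n {1..n}"

definition len :: "nat \<Rightarrow> weyl \<Rightarrow> nat" where
  "len n f = (LEAST k. \<exists>w. set w \<subseteq> {1..n} \<and> length w = k \<and> act n w = f)"

(* Thick building of type E_n as a W-metric space (Abramenko-Brown, Def. 5.1) *)
definition thick_building :: "nat \<Rightarrow> 'c set \<Rightarrow> ('c \<Rightarrow> 'c \<Rightarrow> weyl) \<Rightarrow> bool" where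
  "thick_building n Ch \<delta> \<longleftrightarrow>
     Ch \<noteq> {} \<and>
     (\<forall>C\<in>Ch. \<forall>D\<in>Ch. \<delta> C D \<in> W n) \<and>
     (\<forall>C\<in>Ch. \<forall>D\<in>Ch. \<delta> C D = id \<longleftrightarrow> C = D) \<and>
     (\<forall>C\<in>Ch. \<forall>D\<in>Ch. \<forall>C'\<in>Ch. \<forall>s\<in>{1..n}. \<delta> C' C = refl n s \<longrightarrow>
        (\<delta> C' D = refl n s \<circ> \<delta> C D \<or> \<delta> C' D = \<delta> C D) \<and>
        (len n (refl n s \<circ> \<delta> C D) = len n (\<delta> C D) + 1 \<longrightarrow>
           \<delta> C' D = refl n s \<circ> \<delta> C D)) \<and>
     (\<forall>C\<in>Ch. \<forall>D\<in>Ch. \<forall>s\<in>{1..n}. \<exists>C'\<in>Ch.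
        \<delta> C' C = refl n s \<and> \<delta> C' D = refl n s \<circ> \<delta> C D) \<and>
     (\<forall>C\<in>Ch. \<forall>s\<in>{1..n}. \<exists>D1\<in>Ch. \<exists>D2\<in>Ch.
        D1 \<noteq> D2 \<and> \<delta> D1 C = refl n s \<and> \<delta> D2 C = refl n s)"

definition automorphism :: "nat \<Rightarrow> 'c set \<Rightarrow> ('c \<Rightarrow> 'c \<Rightarrow> weyl) \<Rightarrow> ('c \<Rightarrow> 'c)
    \<Rightarrow> (nat \<Rightarrow> nat) \<Rightarrow> bool" where
  "automorphism n Ch \<delta> \<theta> \<sigma> \<longleftrightarrow>
     bij_betw \<theta> Ch Ch \<and> bij_betw \<sigma> {1..n} {1..n} \<and>
     (\<forall>C\<in>Ch. \<forall>D\<in>Ch. \<forall>i\<in>{1..n}.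
        \<delta> C D = refl n i \<longleftrightarrow> \<delta> (\<theta> C) (\<theta> D) = refl n (\<sigma> i))"

definition opp_type :: "nat \<Rightarrow> nat \<Rightarrow> nat" where
  "opp_type n i = (if n = 6 then (if i = 1 then 6 else if i = 6 then 1
                                  else if i = 3 then 5 else if i = 5 then 3 else i)
                   else i)"

definition oppomorphism :: "nat \<Rightarrow> 'c set \<Rightarrow> ('c \<Rightarrow> 'c \<Rightarrow> weyl) \<Rightarrow> ('c \<Rightarrow> 'c) \<Rightarrow> bool" where
  "oppomorphism n Ch \<delta> \<theta> \<longleftrightarrow> automorphism n Ch \<delta> \<theta> (opp_type n)"

definition opposite :: "nat \<Rightarrow> ('c \<Rightarrow> 'c \<Rightarrow> weyl) \<Rightarrow> 'c \<Rightarrow> 'c \<Rightarrow> bool" where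
  "opposite n \<delta> C D \<longleftrightarrow> (\<forall>w\<in>W n. len n w \<le> len n (\<delta> C D))"

definition anisotropic :: "nat \<Rightarrow> 'c set \<Rightarrow> ('c \<Rightarrow> 'c \<Rightarrow> weyl) \<Rightarrow> ('c \<Rightarrow> 'c) \<Rightarrow> bool" where
  "anisotropic n Ch \<delta> \<theta> \<longleftrightarrow> (\<forall>C\<in>Ch. opposite n \<delta> C (\<theta> C))"

definition domestic :: "nat \<Rightarrow> 'c set \<Rightarrow> ('c \<Rightarrow> 'c \<Rightarrow> weyl) \<Rightarrow> ('c \<Rightarrow> 'c) \<Rightarrow> bool" where
  "domestic n Ch \<delta> \<theta> \<longleftrightarrow> (\<forall>C\<in>Ch. \<not> opposite n \<delta> C (\<theta> C))"

definition res :: "nat \<Rightarrow> nat set \<Rightarrow> 'c set \<Rightarrow> ('c \<Rightarrow> 'c \<Rightarrow> weyl) \<Rightarrow> 'c \<Rightarrow> 'c set" where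
  "res n J Ch \<delta> C = {D \<in> Ch. \<delta> C D \<in> Wsub n J}"

(* point type of the long root subgroup geometry: E_{6,2}, E_{7,1}, E_{8,8} *)
definition pt_type :: "nat \<Rightarrow> nat" where
  "pt_type n = (if n = 6 then 2 else if n = 7 then 1 else 8)"

(* points = vertices of type p, identified with residues of cotype p *)
definition points :: "nat \<Rightarrow> 'c set \<Rightarrow> ('c \<Rightarrow> 'c \<Rightarrow> weyl) \<Rightarrow> 'c set set" where
  "points n Ch \<delta> = res n ({1..n} - {pt_type n}) Ch \<delta> ` Ch"

(* two points are collinear iff they lie on a common line (= p-panel), i.e.
   they contain p-adjacent chambers *)
definition collinear :: "nat \<Rightarrow> ('c \<Rightarrow> 'c \<Rightarrow> weyl) \<Rightarrow> 'c set \<Rightarrow> 'c set \<Rightarrow> bool" where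
  "collinear n \<delta> x y \<longleftrightarrow> (\<exists>C\<in>x. \<exists>D\<in>y. \<delta> C D = refl n (pt_type n))"

definition pos1 :: "nat \<Rightarrow> ('c \<Rightarrow> 'c \<Rightarrow> weyl) \<Rightarrow> 'c set \<Rightarrow> 'c set \<Rightarrow> bool" where
  "pos1 n \<delta> x y \<longleftrightarrow> x \<noteq> y \<and> collinear n \<delta> x y"

definition pos2' :: "nat \<Rightarrow> 'c set \<Rightarrow> ('c \<Rightarrow> 'c \<Rightarrow> weyl) \<Rightarrow> 'c set \<Rightarrow> 'c set \<Rightarrow> bool" where
  "pos2' n Ch \<delta> x y \<longleftrightarrow> x \<noteq> y \<and> \<not> collinear n \<delta> x y \<and>
     (\<exists>!z. z \<in> points n Ch \<delta> \<and> z \<noteq> x \<and> z \<noteq> y \<and>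
            collinear n \<delta> x z \<and> collinear n \<delta> z y)"

definition polar_kangaroo :: "nat \<Rightarrow> 'c set \<Rightarrow> ('c \<Rightarrow> 'c \<Rightarrow> weyl) \<Rightarrow> ('c \<Rightarrow> 'c) \<Rightarrow> bool" where
  "polar_kangaroo n Ch \<delta> \<theta> \<longleftrightarrow>
     (\<forall>x\<in>points n Ch \<delta>. \<not> pos1 n \<delta> x (\<theta> ` x) \<and> \<not> pos2' n Ch \<delta> x (\<theta> ` x))"

end

theory Submission
  imports Defs
begin

text \<open>Let \<open>hr\<close> be the highest root. The mutual position of the points of chambers \<open>C\<close> and \<open>D\<close>
  is read off from the inner product of \<open>hr\<close> with \<open>\<delta> C D hr\<close>, the values \<open>2, 1, 0, -1, -2\<close>
  corresponding to \<open>0, 1, 2, 2', 3\<close>; so a polar kangaroo is one for which this product is never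
  \<open>1\<close> or \<open>-1\<close> when \<open>D = \<theta> C\<close>.

  Let \<open>f\<close> be the longest element of the Weyl group or, if \<open>\<theta>\<close> preserves types, the identity. Then
  \<open>f\<close> intertwines each simple reflection with its \<open>\<theta>\<close>-conjugate and maps \<open>hr\<close> to \<open>hr\<close> or \<open>- hr\<close>.
  If some chamber has displacement \<open>f\<close> and not all have, then by connectedness some chamber has
  displacement \<open>s f\<close> with \<open>s\<close> a simple reflection. Walking through adjacent chambers along the
  Dynkin path from \<open>s\<close> to the polar node turns this into a displacement \<open>u f\<close> such that \<open>u hr\<close>
  and \<open>hr\<close> have product \<open>1\<close>, whichever of the two possible displacements occurs at each step,
  which is impossible for a kangaroo. So one chamber of displacement \<open>f\<close> forces all chambers to
  have displacement \<open>f\<close>.\<close>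

section \<open>The root lattice\<close>

definition alpha :: "nat \<Rightarrow> nat \<Rightarrow> int" where
  "alpha i = (\<lambda>k. if k = i then 1 else 0)"

definition B :: "nat \<Rightarrow> (nat \<Rightarrow> int) \<Rightarrow> (nat \<Rightarrow> int) \<Rightarrow> int" where
  "B n u v = (\<Sum>i\<in>{1..n}. \<Sum>j\<in>{1..n}. cartan i j * u i * v j)"

text \<open>\<open>weyl\<close> acts on all functions \<open>nat \<Rightarrow> int\<close> and
  leaves the coordinates outside \<open>{1..n}\<close> alone, while \<open>B\<close> does not see
  them. This predicate singles out the root lattice, on which \<open>B\<close> is definite.\<close>

definition supported :: "nat \<Rightarrow> (nat \<Rightarrow> int) \<Rightarrow> bool" where
  "supported n v \<longleftrightarrow> (\<forall>k. k \<notin> {1..n} \<longrightarrow> v k = 0)"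

text \<open>In a simply laced lattice of finite type the roots are the vectors of norm 2. With this
  description, invariance under the Weyl group is immediate from isometry.\<close>

definition is_root :: "nat \<Rightarrow> (nat \<Rightarrow> int) \<Rightarrow> bool" where
  "is_root n v \<longleftrightarrow> supported n v \<and> B n v v = 2"

definition pos_root :: "nat \<Rightarrow> (nat \<Rightarrow> int) \<Rightarrow> bool" where
  "pos_root n v \<longleftrightarrow> is_root n v \<and> (\<forall>k. 0 \<le> v k)"

lemma alpha_simps [simp]: "alpha i i = 1" "k \<noteq> i \<Longrightarrow> alpha i k = 0"
  by (simp_all add: alpha_def)

lemma cartan_sym: "cartan i j = cartan j i"
  by (simp add: cartan_def E_edge_def insert_commute)

lemma cartan_diag [simp]: "cartan i i = 2"
  by (simp add: cartan_def)

lemma cartan_off: "i \<noteq> j \<Longrightarrow> cartan i j \<le> 0"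
  by (simp add: cartan_def)

lemma B_sym: "B n u v = B n v u"
  unfolding B_def by (subst sum.swap) (simp add: cartan_sym mult.commute mult.left_commute)

lemma B_lin: "B n (\<lambda>k. a * u k + b * v k) w = a * B n u w + b * B n v w"
  by (simp add: B_def sum_distrib_left sum.distrib[symmetric] algebra_simps)

lemma B_lin2: "B n w (\<lambda>k. a * u k + b * v k) = a * B n w u + b * B n w v"
  by (subst (1 2 3) B_sym) (rule B_lin)

lemma B_add: "B n (\<lambda>k. u k + v k) w = B n u w + B n v w"
  "B n w (\<lambda>k. u k + v k) = B n w u + B n w v"
  using B_lin[of n 1 u 1 v w] B_lin2[of n w 1 u 1 v] by simp_all

lemma B_diff: "B n (\<lambda>k. u k - v k) w = B n u w - B n v w"
  "B n w (\<lambda>k. u k - v k) = B n w u - B n w v"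
  using B_lin[of n 1 u "-1" v w] B_lin2[of n w 1 u "-1" v] by simp_all

lemma B_scale: "B n (\<lambda>k. a * u k) w = a * B n u w"
  "B n w (\<lambda>k. a * u k) = a * B n w u"
  using B_lin[of n a u 0 u w] B_lin2[of n w a u 0 u] by simp_all

lemma B_uminus: "B n (\<lambda>k. - u k) w = - B n u w" "B n w (\<lambda>k. - u k) = - B n w u"
  using B_scale[where a = "-1" and n = n] by simp_all

lemma B_alpha: "i \<in> {1..n} \<Longrightarrow> B n (alpha i) v = (\<Sum>j\<in>{1..n}. cartan i j * v j)"
proof -
  assume i: "i \<in> {1..n}"
  have "B n (alpha i) v = (\<Sum>k\<in>{1..n}. if k = i then (\<Sum>j\<in>{1..n}. cartan i j * v j) else 0)"
    unfolding B_def by (rule sum.cong) (auto simp: alpha_def)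
  then show ?thesis using i by simp
qed

lemma B_expand: "B n u v = (\<Sum>i\<in>{1..n}. u i * B n (alpha i) v)"
  unfolding B_def[of n u]
  by (rule sum.cong) (simp_all add: B_alpha sum_distrib_left mult.assoc mult.left_commute)

lemma B_alpha_alpha:
  assumes "i \<in> {1..n}" "j \<in> {1..n}"
  shows "B n (alpha i) (alpha j) = cartan i j"
proof -
  have "(\<Sum>k\<in>{1..n}. cartan i k * alpha j k) = (\<Sum>k\<in>{1..n}. if k = j then cartan i j else 0)"
    by (rule sum.cong) (auto simp: alpha_def)
  then show ?thesis using assms by (simp add: B_alpha)
qed

lemma supported_alpha: "i \<in> {1..n} \<Longrightarrow> supported n (alpha i)"
  by (auto simp: supported_def alpha_def)

lemma pos_root_alpha: "i \<in> {1..n} \<Longrightarrow> pos_root n (alpha i)"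
  unfolding pos_root_def is_root_def
  by (simp add: supported_alpha B_alpha_alpha) (simp add: alpha_def)

lemma is_root_uminus: "is_root n v \<Longrightarrow> is_root n (\<lambda>k. - v k)"
  by (simp add: is_root_def supported_def B_uminus)

section \<open>The reflection representation\<close>

lemma refl_eq: "i \<in> {1..n} \<Longrightarrow> refl n i v = (\<lambda>k. v k - B n v (alpha i) * alpha i k)"
proof
  fix k
  assume "i \<in> {1..n}"
  then show "refl n i v k = v k - B n v (alpha i) * alpha i k"
    by (cases "k = i") (simp_all add: refl_def B_sym[of n v] B_alpha)
qed

lemma refl_refl [simp]: "i \<in> {1..n} \<Longrightarrow> refl n i (refl n i v) = v"
  by (simp add: refl_eq B_diff B_scale B_alpha_alpha)

lemma refl_comp [simp]: "i \<in> {1..n} \<Longrightarrow> refl n i \<circ> refl n i = id"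
  by (rule ext) simp

lemma refl_isometry: "i \<in> {1..n} \<Longrightarrow> B n (refl n i u) v = B n u (refl n i v)"
  by (simp add: refl_eq B_diff B_scale B_sym[of n "alpha i"])

lemma refl_neq_id: "i \<in> {1..n} \<Longrightarrow> refl n i \<noteq> id"
proof
  assume i: "i \<in> {1..n}" and "refl n i = id"
  then have "refl n i (alpha i) i = alpha i i" by simp
  then show False using i by (simp add: refl_eq B_alpha_alpha)
qed

lemma act_append: "act n (v @ w) = act n v \<circ> act n w"
  by (induction v) auto

lemma act_rev1: "set w \<subseteq> {1..n} \<Longrightarrow> act n (rev w) (act n w v) = v"
  by (induction w arbitrary: v) (simp_all add: act_append)

lemma act_rev2: "set w \<subseteq> {1..n} \<Longrightarrow> act n w (act n (rev w) v) = v"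
  using act_rev1[of "rev w"] by simp

lemma act_lin: "set w \<subseteq> {1..n} \<Longrightarrow>
  act n w (\<lambda>k. a * u k + b * v k) = (\<lambda>k. a * act n w u k + b * act n w v k)"
proof (induction w)
  case (Cons i w)
  then show ?case by (auto simp: refl_eq B_lin algebra_simps)
qed simp

lemma act_isometry: "set w \<subseteq> {1..n} \<Longrightarrow> B n (act n w u) v = B n u (act n (rev w) v)"
  by (induction w arbitrary: u v) (simp_all add: refl_isometry act_append)

lemma act_unchanged: "k \<notin> set w \<Longrightarrow> act n w v k = v k"
  by (induction w arbitrary: v) (simp_all add: refl_def)

lemma Wsub_mono: "J \<subseteq> K \<Longrightarrow> Wsub n J \<subseteq> Wsub n K"
  unfolding Wsub_def by blast

lemma Wsub_id [simp]: "id \<in> Wsub n J"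
  unfolding Wsub_def by (auto intro!: exI[of _ "[]"])

lemma Wsub_refl [simp]: "i \<in> J \<Longrightarrow> refl n i \<in> Wsub n J"
  unfolding Wsub_def by (auto intro!: exI[of _ "[i]"])

lemma Wsub_comp: "f \<in> Wsub n J \<Longrightarrow> g \<in> Wsub n J \<Longrightarrow> f \<circ> g \<in> Wsub n J"
proof -
  assume "f \<in> Wsub n J" "g \<in> Wsub n J"
  then obtain v w where "f = act n v" "set v \<subseteq> J" "g = act n w" "set w \<subseteq> J"
    unfolding Wsub_def by auto
  then show ?thesis
    unfolding Wsub_def using act_append[of n v w] by (auto intro!: exI[of _ "v @ w"])
qed

lemma inv_act:
  assumes "set w \<subseteq> {1..n}"
  shows "inv (act n w) = act n (rev w)"
  using assms by (intro inv_unique_comp ext) (simp_all add: act_rev1 act_rev2)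

lemma W_bij: "f \<in> W n \<Longrightarrow> bij f"
proof -
  assume "f \<in> W n"
  then obtain w where "f = act n w" "set w \<subseteq> {1..n}" unfolding Wsub_def by auto
  then show ?thesis by (intro o_bij[of "act n (rev w)"] ext) (simp_all add: act_rev1 act_rev2)
qed

lemma Wsub_inv: "J \<subseteq> {1..n} \<Longrightarrow> f \<in> Wsub n J \<Longrightarrow> inv f \<in> Wsub n J"
proof -
  assume J: "J \<subseteq> {1..n}" and "f \<in> Wsub n J"
  then obtain w where w: "f = act n w" "set w \<subseteq> J" unfolding Wsub_def by auto
  then have "inv f = act n (rev w)" using J by (simp add: inv_act)
  then show ?thesis using w(2) unfolding Wsub_def by (auto intro!: exI[of _ "rev w"])
qed

lemma W_isometry: "f \<in> W n \<Longrightarrow> B n (f u) v = B n u (inv f v)"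
  unfolding Wsub_def by (auto simp: inv_act act_isometry)

lemma W_inv_inv: "f \<in> W n \<Longrightarrow> inv (inv f) = f"
  by (simp add: W_bij inv_inv_eq)

lemma W_inv_cancel: "f \<in> W n \<Longrightarrow> f (inv f v) = v" "f \<in> W n \<Longrightarrow> inv f (f v) = v"
  using W_bij[of f n] by (simp_all add: bij_is_inj bij_is_surj surj_f_inv_f)

lemma W_isometry2: "f \<in> W n \<Longrightarrow> B n (f u) (f v) = B n u v"
  by (simp add: W_isometry W_inv_cancel)

lemma W_lin: "f \<in> W n \<Longrightarrow> f (\<lambda>k. a * u k + b * v k) = (\<lambda>k. a * f u k + b * f v k)"
  unfolding Wsub_def by (auto simp: act_lin)

lemma W_scale: "f \<in> W n \<Longrightarrow> f (\<lambda>k. a * u k) = (\<lambda>k. a * f u k)"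
  using W_lin[of f n a u 0 u] by simp

lemma W_diff: "f \<in> W n \<Longrightarrow> f (\<lambda>k. u k - v k) = (\<lambda>k. f u k - f v k)"
  using W_lin[of f n 1 u "-1" v] by simp

lemma W_uminus: "f \<in> W n \<Longrightarrow> f (\<lambda>k. - u k) = (\<lambda>k. - f u k)"
  using W_scale[of f n "-1" u] by simp

lemma W_sum:
  assumes "f \<in> W n" "finite A"
  shows "f (\<lambda>k. \<Sum>j\<in>A. c j * u j k) = (\<lambda>k. \<Sum>j\<in>A. c j * f (u j) k)"
  using assms(2)
proof (induction A)
  case empty
  show ?case using W_scale[OF assms(1), of 0] by simp
next
  case (insert x A)
  then show ?case
    using W_lin[OF assms(1), of "c x" "u x" 1 "\<lambda>k. \<Sum>j\<in>A. c j * u j k"] by simp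
qed

lemma supported_expand: "supported n v \<Longrightarrow> v = (\<lambda>k. \<Sum>j\<in>{1..n}. v j * alpha j k)"
proof
  fix k assume v: "supported n v"
  have "(\<Sum>j\<in>{1..n}. v j * alpha j k) = (\<Sum>j\<in>{1..n}. if j = k then v k else 0)"
    by (rule sum.cong) (auto simp: alpha_def)
  then show "v k = (\<Sum>j\<in>{1..n}. v j * alpha j k)"
    using v by (auto simp: supported_def)
qed

lemma W_supported: "f \<in> W n \<Longrightarrow> supported n v \<Longrightarrow> supported n (f v)"
  unfolding Wsub_def supported_def using act_unchanged by fastforce

lemma W_root: "f \<in> W n \<Longrightarrow> is_root n v \<Longrightarrow> is_root n (f v)"
  unfolding is_root_def by (simp add: W_supported W_isometry2)

lemma W_sum_alpha:
  "f \<in> W n \<Longrightarrow> supported n v \<Longrightarrow> f v = (\<lambda>k. \<Sum>j\<in>{1..n}. v j * f (alpha j) k)"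
  by (subst supported_expand, assumption) (simp add: W_sum)

section \<open>Positive definiteness in type $E_n$\<close>

lemma interval8: "{1..8} = {1, 2, 3, 4, 5, 6, 7, 8 :: nat}" by auto

text \<open>Squares are completed along the three arms of the diagram, from their ends towards the
  branch node 4. What remains there is \<open>2 - 1/2 - 2/3 - 4/5 = 1/30\<close> times the square of
  \<open>v 4\<close>; the factor 60 clears denominators.\<close>

lemma B8_sos:
  "60 * B 8 v v = 30 * (2 * v 2 - v 4)\<^sup>2 + 30 * (2 * v 1 - v 3)\<^sup>2 + 10 * (3 * v 3 - 2 * v 4)\<^sup>2
     + 30 * (2 * v 8 - v 7)\<^sup>2 + 10 * (3 * v 7 - 2 * v 6)\<^sup>2 + 5 * (4 * v 6 - 3 * v 5)\<^sup>2
     + 3 * (5 * v 5 - 4 * v 4)\<^sup>2 + 2 * (v 4)\<^sup>2"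
  unfolding B_def interval8
  by (simp add: cartan_def E_edge_def doubleton_eq_iff power2_eq_square algebra_simps)

lemma B8_half:
  "B 8 v v = 2 * ((v 1)\<^sup>2 + (v 2)\<^sup>2 + (v 3)\<^sup>2 + (v 4)\<^sup>2 + (v 5)\<^sup>2 + (v 6)\<^sup>2 + (v 7)\<^sup>2 + (v 8)\<^sup>2
     - v 1 * v 3 - v 3 * v 4 - v 4 * v 5 - v 5 * v 6 - v 6 * v 7 - v 7 * v 8 - v 2 * v 4)"
  unfolding B_def interval8
  by (simp add: cartan_def E_edge_def doubleton_eq_iff power2_eq_square algebra_simps)

lemma B8_even: "even (B 8 v v)"
  by (simp add: B8_half)

text \<open>The nodes \<open>1..n\<close> span a subdiagram of $E_8$, so the one sum of squares for
  $E_8$ also serves $E_6$ and $E_7$.\<close>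

lemma B8_restrict:
  assumes "n \<le> 8" "supported n v"
  shows "B n v v = B 8 v v"
proof -
  have "(\<Sum>j\<in>{1..n}. cartan i j * v i * v j) = (\<Sum>j\<in>{1..8}. cartan i j * v i * v j)" for i
    using assms by (intro sum.mono_neutral_left) (auto simp: supported_def)
  moreover have "(\<Sum>i\<in>{1..n}. \<Sum>j\<in>{1..8}. cartan i j * v i * v j)
      = (\<Sum>i\<in>{1..8}. \<Sum>j\<in>{1..8}. cartan i j * v i * v j)"
    using assms by (intro sum.mono_neutral_left) (auto simp: supported_def intro!: sum.neutral)
  ultimately show ?thesis by (simp add: B_def)
qed

locale type_E =
  fixes n :: nat
  assumes n_cases: "n \<in> {6, 7, 8}"
begin

abbreviation p :: nat where "p \<equiv> pt_type n"
abbreviation J :: "nat set" where "J \<equiv> {1..n} - {p}"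

lemma p_range: "p \<in> {1..n}"
  using n_cases by (auto simp: pt_type_def)

text \<open>If the sum of squares vanishes, so does \<open>v 4\<close>, and then all coordinates
  along the arms. Evenness of the form improves positivity to the bound 2.\<close>

lemma B_pos: "supported n v \<Longrightarrow> v \<noteq> (\<lambda>k. 0) \<Longrightarrow> 2 \<le> B n v v"
proof -
  assume v: "supported n v" "v \<noteq> (\<lambda>k. 0)"
  have n8: "n \<le> 8" using n_cases by auto
  have eq: "B n v v = B 8 v v" by (rule B8_restrict[OF n8 v(1)])
  have "0 < B 8 v v"
  proof (rule ccontr)
    assume "\<not> 0 < B 8 v v"
    then have le: "60 * B 8 v v \<le> 0" by simp
    have nn: "0 \<le> (2 * v 2 - v 4)\<^sup>2" "0 \<le> (2 * v 1 - v 3)\<^sup>2" "0 \<le> (3 * v 3 - 2 * v 4)\<^sup>2"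
      "0 \<le> (2 * v 8 - v 7)\<^sup>2" "0 \<le> (3 * v 7 - 2 * v 6)\<^sup>2" "0 \<le> (4 * v 6 - 3 * v 5)\<^sup>2"
      "0 \<le> (5 * v 5 - 4 * v 4)\<^sup>2" "0 \<le> (v 4)\<^sup>2" by simp_all
    have "(2 * v 2 - v 4)\<^sup>2 = 0" "(2 * v 1 - v 3)\<^sup>2 = 0" "(3 * v 3 - 2 * v 4)\<^sup>2 = 0"
      "(2 * v 8 - v 7)\<^sup>2 = 0" "(3 * v 7 - 2 * v 6)\<^sup>2 = 0" "(4 * v 6 - 3 * v 5)\<^sup>2 = 0"
      "(5 * v 5 - 4 * v 4)\<^sup>2 = 0" "(v 4)\<^sup>2 = 0"
      using nn le unfolding B8_sos by linarith+
    then have "v 1 = 0" "v 2 = 0" "v 3 = 0" "v 4 = 0" "v 5 = 0" "v 6 = 0" "v 7 = 0" "v 8 = 0"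
      by simp_all
    then have "v k = 0" if "k \<in> {1..8}" for k
      using that unfolding interval8 by auto
    moreover have "v k = 0" if "k \<notin> {1..8}" for k
      using that v(1) n8 by (auto simp: supported_def)
    ultimately show False using v(2) by blast
  qed
  then show ?thesis using B8_even[of v] unfolding eq by presburger
qed

section \<open>Inner products and signs of roots\<close>

lemma supported_diff: "supported n u \<Longrightarrow> supported n v \<Longrightarrow> supported n (\<lambda>k. u k - v k)"
  by (simp add: supported_def)

lemma root_neq_0: "is_root n v \<Longrightarrow> \<exists>k. v k \<noteq> 0"
proof (rule ccontr)
  assume v: "is_root n v" "\<nexists>k. v k \<noteq> 0"
  then have "v = (\<lambda>k. 0)" by auto
  then show False using v B_scale(1)[of n 0 v v] by (auto simp: is_root_def)
qed

text \<open>Otherwise the nonzero vector \<open>u - v\<close> would have norm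
  \<open>4 - 2 * B n u v \<le> 0\<close>.\<close>

lemma root_product_2:
  assumes "is_root n u" "is_root n v" "B n u v \<ge> 2"
  shows "u = v"
proof (rule ccontr)
  assume "u \<noteq> v"
  then have "(\<lambda>k. u k - v k) \<noteq> (\<lambda>k. 0)" by (auto simp: fun_eq_iff)
  moreover have "supported n (\<lambda>k. u k - v k)"
    using assms by (simp add: is_root_def supported_diff)
  ultimately have "2 \<le> B n (\<lambda>k. u k - v k) (\<lambda>k. u k - v k)" by (rule B_pos[rotated])
  then show False using assms by (simp add: B_diff is_root_def B_sym[of n v u])
qed

lemma root_product_m2:
  assumes "is_root n u" "is_root n v" "B n u v \<le> -2"
  shows "u = (\<lambda>k. - v k)"
  using assms by (intro root_product_2) (simp_all add: is_root_uminus B_uminus)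

text \<open>The positive and negative parts of a root have nonpositive product, so they cannot both
  be nonzero vectors of the even lattice.\<close>

lemma root_sign:
  assumes v: "is_root n v"
  shows "(\<forall>k. 0 \<le> v k) \<or> (\<forall>k. v k \<le> 0)"
proof (rule ccontr)
  define a where "a = (\<lambda>k. max (v k) 0)"
  define b where "b = (\<lambda>k. max (- v k) 0)"
  assume "\<not> ?thesis"
  then have "a \<noteq> (\<lambda>k. 0)" "b \<noteq> (\<lambda>k. 0)"
    by (auto simp: a_def b_def fun_eq_iff max_def not_le split: if_splits)
  moreover have "supported n a" "supported n b"
    using v by (auto simp: is_root_def supported_def a_def b_def)
  ultimately have ge: "2 \<le> B n a a" "2 \<le> B n b b" by (simp_all add: B_pos)
  have "B n a b \<le> 0"
    unfolding B_def
  proof (intro sum_nonpos)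
    fix i j
    show "cartan i j * a i * b j \<le> 0"
    proof (cases "i = j")
      case True
      then show ?thesis by (simp add: a_def b_def max_def)
    next
      case False
      then have "cartan i j * (a i * b j) \<le> 0"
        by (intro mult_nonpos_nonneg) (simp_all add: cartan_off a_def b_def)
      then show ?thesis by (simp add: mult.assoc)
    qed
  qed
  moreover have "v = (\<lambda>k. a k - b k)" by (auto simp: a_def b_def)
  then have "B n v v = B n a a + B n b b - 2 * B n a b"
    by (simp add: B_diff B_sym[of n b a])
  ultimately show False using ge v by (simp add: is_root_def)
qed

lemma pos_rootI: "is_root n v \<Longrightarrow> 0 < v k \<Longrightarrow> pos_root n v"
  using root_sign[of v] by (metis not_le pos_root_def)

lemma not_pos_root: "is_root n v \<Longrightarrow> \<not> pos_root n v \<Longrightarrow> v k \<le> 0"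
  using pos_rootI[of v k] by force

lemma not_pos_root_uminus: "is_root n v \<Longrightarrow> \<not> pos_root n v \<longleftrightarrow> pos_root n (\<lambda>k. - v k)"
proof
  assume v: "is_root n v" and "\<not> pos_root n v"
  then have "v k \<le> 0" for k by (rule not_pos_root)
  then show "pos_root n (\<lambda>k. - v k)" using v by (simp add: pos_root_def is_root_uminus)
next
  assume v: "is_root n v" and neg: "pos_root n (\<lambda>k. - v k)"
  obtain k where "v k \<noteq> 0" using root_neq_0[OF v] by blast
  moreover have "v k \<le> 0" using neg by (simp add: pos_root_def)
  ultimately have "\<not> 0 \<le> v k" by simp
  then show "\<not> pos_root n v" by (auto simp: pos_root_def)
qed

section \<open>The highest root\<close>

definition hr :: "nat \<Rightarrow> int" where
  "hr = (\<lambda>k. if k \<in> {1..n} then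
     (if n = 6 then [1,2,2,3,2,1] else if n = 7 then [2,2,3,4,3,2,1] else [2,3,4,6,5,4,3,2]) ! (k - 1)
     else 0)"

lemma supported_hr: "supported n hr"
  by (simp add: supported_def hr_def)

text \<open>The extra node of the extended Dynkin diagram is joined to the polar node alone, so
  \<open>hr\<close> is the fundamental weight of \<open>p\<close>.\<close>

lemma hr_alpha:
  assumes i: "i \<in> {1..n}"
  shows "B n hr (alpha i) = (if i = p then 1 else 0)"
proof -
  have eq: "B n hr (alpha i) = (\<Sum>j\<in>{1..n}. cartan i j * hr j)"
    using i by (simp add: B_sym[of n hr] B_alpha)
  consider "n = 6" | "n = 7" | "n = 8" using n_cases by auto
  then show ?thesis
  proof cases
    case 1
    then have "hr 1 = 1" "hr 2 = 2" "hr 3 = 2" "hr 4 = 3" "hr 5 = 2" "hr 6 = 1" "p = 2"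
      unfolding hr_def pt_type_def by simp_all
    moreover have "{1..n} = {1,2,3,4,5,6}" using 1 by auto
    ultimately show ?thesis using i unfolding eq
      by (auto simp: cartan_def E_edge_def doubleton_eq_iff simp del: One_nat_def)
  next
    case 2
    then have "hr 1 = 2" "hr 2 = 2" "hr 3 = 3" "hr 4 = 4" "hr 5 = 3" "hr 6 = 2" "hr 7 = 1" "p = 1"
      unfolding hr_def pt_type_def by simp_all
    moreover have "{1..n} = {1,2,3,4,5,6,7}" using 2 by auto
    ultimately show ?thesis using i unfolding eq
      by (auto simp: cartan_def E_edge_def doubleton_eq_iff simp del: One_nat_def)
  next
    case 3
    then have "hr 1 = 2" "hr 2 = 3" "hr 3 = 4" "hr 4 = 6" "hr 5 = 5" "hr 6 = 4" "hr 7 = 3" "hr 8 = 2"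
      "p = 8"
      unfolding hr_def pt_type_def by simp_all
    moreover have "{1..n} = {1,2,3,4,5,6,7,8}" using 3 by auto
    ultimately show ?thesis using i unfolding eq
      by (auto simp: cartan_def E_edge_def doubleton_eq_iff simp del: One_nat_def)
  qed
qed

text \<open>Since \<open>hr\<close> is dual to the coordinate at \<open>p\<close>, inner products
  with \<open>hr\<close>, and with them mutual positions of points, are read off from a single
  coordinate.\<close>

lemma B_hr: "B n hr v = v p"
proof -
  have "B n v hr = (\<Sum>i\<in>{1..n}. if i = p then v p else 0)"
    by (subst B_expand, rule sum.cong) (simp_all add: B_sym[of n _ hr] hr_alpha)
  then show ?thesis using p_range by (simp add: B_sym[of n hr])
qed

lemma hr_p: "hr p = 2"
  using n_cases by (auto simp: hr_def pt_type_def)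

lemma root_hr: "is_root n hr"
  by (simp add: is_root_def supported_hr B_hr hr_p)

lemma refl_hr: "i \<in> J \<Longrightarrow> refl n i hr = hr"
  by (simp add: refl_eq hr_alpha)

lemma refl_p_hr: "refl n p hr = (\<lambda>k. hr k - alpha p k)"
  using p_range by (simp add: refl_eq hr_alpha)

section \<open>The exchange condition\<close>

text \<open>The reflection in an arbitrary vector of norm 2; it lets conjugates of simple
  reflections be named by their roots.\<close>

definition sroot :: "(nat \<Rightarrow> int) \<Rightarrow> weyl" where
  "sroot \<beta> v = (\<lambda>k. v k - B n v \<beta> * \<beta> k)"

lemma sroot_alpha: "i \<in> {1..n} \<Longrightarrow> sroot (alpha i) = refl n i"
  by (rule ext) (simp add: sroot_def refl_eq)

lemma W_sroot: "f \<in> W n \<Longrightarrow> f (sroot \<beta> v) = sroot (f \<beta>) (f v)"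
  using W_lin[of f n 1 v "- B n v \<beta>" \<beta>] by (simp add: sroot_def W_isometry2)

lemma refl_in_W: "i \<in> {1..n} \<Longrightarrow> refl n i \<in> W n"
  by simp

text \<open>The reflection changes only coordinate \<open>i\<close>. If the image is not positive,
  all other coordinates of \<open>\<beta>\<close> are both nonnegative and nonpositive, and norm 2
  leaves only \<open>alpha i\<close>.\<close>

lemma pos_root_refl:
  assumes \<beta>: "pos_root n \<beta>" and i: "i \<in> {1..n}" and neg: "\<not> pos_root n (refl n i \<beta>)"
  shows "\<beta> = alpha i"
proof -
  have r: "is_root n (refl n i \<beta>)" using \<beta> W_root[OF refl_in_W[OF i]] by (simp add: pos_root_def)
  have "\<beta> k = 0" if "k \<noteq> i" for k
    using not_pos_root[OF r neg, of k] \<beta> that i by (simp add: pos_root_def refl_eq order_antisym)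
  then have eq: "\<beta> = (\<lambda>k. \<beta> i * alpha i k)" by (auto simp: fun_eq_iff alpha_def)
  have "B n \<beta> \<beta> = \<beta> i * (\<beta> i * 2)"
    using B_alpha_alpha[OF i i] by (subst (1 2) eq) (simp add: B_scale)
  then have "\<beta> i * \<beta> i = 1" using \<beta> by (simp add: pos_root_def is_root_def)
  moreover have "\<beta> i \<ge> 0" using \<beta> by (simp add: pos_root_def)
  ultimately have "\<beta> i = 1" by (simp add: zmult_eq_1_iff)
  then show ?thesis by (subst eq) simp
qed

text \<open>The letters of \<open>w\<close> are applied to \<open>\<beta>\<close> one after the
  other from the left; the letter at which the sign first changes is deleted. Arbitrary positive
  \<open>\<beta>\<close> are allowed because the induction moves the root, and
  \<open>set w' \<subseteq> set w\<close> keeps the exchange inside a parabolic subgroup.\<close>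

lemma exchange_root:
  assumes "set w \<subseteq> {1..n}" "pos_root n \<beta>" "\<not> pos_root n (act n (rev w) \<beta>)"
  shows "\<exists>w'. set w' \<subseteq> set w \<and> length w' < length w \<and> act n w' = sroot \<beta> \<circ> act n w"
  using assms
proof (induction w arbitrary: \<beta>)
  case Nil
  then show ?case by simp
next
  case (Cons s w)
  then have s: "s \<in> {1..n}" and w: "set w \<subseteq> {1..n}" by auto
  have conj: "sroot \<beta> (refl n s v) = refl n s (sroot (refl n s \<beta>) v)" for v
    using W_sroot[OF refl_in_W[OF s], of "refl n s \<beta>" v] s by simp
  show ?case
  proof (cases "pos_root n (refl n s \<beta>)")
    case True
    moreover have "\<not> pos_root n (act n (rev w) (refl n s \<beta>))"
      using Cons.prems(3) by (simp add: act_append)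
    ultimately obtain w' where w': "set w' \<subseteq> set w" "length w' < length w"
      "act n w' = sroot (refl n s \<beta>) \<circ> act n w" using Cons.IH[OF w] by blast
    then have "act n (s # w') = sroot \<beta> \<circ> act n (s # w)" by (intro ext) (simp add: conj)
    then show ?thesis using w' by (intro exI[of _ "s # w'"]) auto
  next
    case False
    then have "\<beta> = alpha s" using pos_root_refl Cons.prems(2) s by blast
    then have eq: "act n w = sroot \<beta> \<circ> act n (s # w)"
      using s by (intro ext) (simp add: sroot_alpha)
    show ?thesis by (intro exI[of _ w] conjI eq) auto
  qed
qed

lemma exchange:
  assumes "set w \<subseteq> {1..n}" "i \<in> {1..n}" "\<not> pos_root n (act n (rev w) (alpha i))"
  shows "\<exists>w'. set w' \<subseteq> set w \<and> length w' < length w \<and> act n w' = refl n i \<circ> act n w"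
  using exchange_root[of w "alpha i"] assms by (simp add: pos_root_alpha sroot_alpha)

section \<open>Length and signs of roots\<close>

lemma len_act: "set w \<subseteq> {1..n} \<Longrightarrow> len n (act n w) \<le> length w"
  unfolding len_def by (rule Least_le) auto

lemma reduced_word:
  assumes "f \<in> W n"
  obtains w where "set w \<subseteq> {1..n}" "act n w = f" "length w = len n f"
proof -
  have "\<exists>k w. set w \<subseteq> {1..n} \<and> length w = k \<and> act n w = f"
    using assms unfolding Wsub_def by auto
  then have "\<exists>w. set w \<subseteq> {1..n} \<and> length w = len n f \<and> act n w = f"
    unfolding len_def by (rule LeastI_ex)
  then show ?thesis using that by auto
qed

lemma len_refl_le:
  assumes "f \<in> W n" "i \<in> {1..n}"
  shows "len n (refl n i \<circ> f) \<le> len n f + 1"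
proof -
  obtain w where "set w \<subseteq> {1..n}" "act n w = f" "length w = len n f"
    using reduced_word[OF assms(1)] .
  then show ?thesis using assms(2) len_act[of "i # w"] by auto
qed

lemma len_inv: "f \<in> W n \<Longrightarrow> len n (inv f) = len n f"
proof -
  have le: "len n (inv f) \<le> len n f" if f: "f \<in> W n" for f
  proof -
    obtain w where w: "set w \<subseteq> {1..n}" "act n w = f" "length w = len n f"
      using reduced_word[OF f] .
    then have "inv f = act n (rev w)" using inv_act by blast
    then show ?thesis using w len_act[of "rev w"] by auto
  qed
  assume f: "f \<in> W n"
  then show ?thesis using le[OF f] le[OF Wsub_inv[OF _ f]] by (simp add: W_inv_inv)
qed

lemma len_down:
  assumes f: "f \<in> W n" and i: "i \<in> {1..n}" and "\<not> pos_root n (inv f (alpha i))"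
  shows "len n (refl n i \<circ> f) < len n f"
proof -
  obtain w where w: "set w \<subseteq> {1..n}" "act n w = f" "length w = len n f"
    using reduced_word[OF f] .
  then have "\<not> pos_root n (act n (rev w) (alpha i))" using assms(3) by (auto simp: inv_act)
  then obtain w' where "set w' \<subseteq> set w" "length w' < length w" "act n w' = refl n i \<circ> act n w"
    using exchange w(1) i by blast
  then show ?thesis using w len_act[of w'] by (metis le_less_trans subset_trans)
qed

lemma inv_refl_comp: "f \<in> W n \<Longrightarrow> i \<in> {1..n} \<Longrightarrow> inv (refl n i \<circ> f) = inv f \<circ> refl n i"
  using o_inv_distrib[of "refl n i" f] W_bij[of f n] W_bij[of "refl n i" n]
    inv_unique_comp[of "refl n i" "refl n i"] by simp

text \<open>Passing to \<open>refl n i \<circ> f\<close> reverses the sign of the root, so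
  \<open>len_down\<close> applies there and shows a strict increase, which
  \<open>len_refl_le\<close> limits to 1.\<close>

lemma len_up:
  assumes f: "f \<in> W n" and i: "i \<in> {1..n}" and pos: "pos_root n (inv f (alpha i))"
  shows "len n (refl n i \<circ> f) = len n f + 1"
proof -
  have W: "refl n i \<circ> f \<in> W n" using f i by (simp add: Wsub_comp)
  have "refl n i (alpha i) = (\<lambda>k. - alpha i k)" using i by (simp add: refl_eq B_alpha_alpha)
  then have "inv (refl n i \<circ> f) (alpha i) = (\<lambda>k. - inv f (alpha i) k)"
    using W_uminus[OF Wsub_inv[OF _ f]] by (simp add: inv_refl_comp[OF f i])
  moreover have "is_root n (inv f (alpha i))" using pos by (simp add: pos_root_def)
  ultimately have "\<not> pos_root n (inv (refl n i \<circ> f) (alpha i))"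
    using pos not_pos_root_uminus is_root_uminus by fastforce
  from len_down[OF W i this] have "len n f < len n (refl n i \<circ> f)"
    using i by (simp add: comp_assoc[symmetric])
  then show ?thesis using len_refl_le[OF f i] by simp
qed

end

section \<open>The longest element\<close>

lemma E_edge_cases: "E_edge i j \<longleftrightarrow>
  i = 1 \<and> j = 3 \<or> i = 3 \<and> j = 1 \<or> i = 3 \<and> j = 4 \<or> i = 4 \<and> j = 3 \<or> i = 4 \<and> j = 5 \<or> i = 5 \<and> j = 4 \<or>
  i = 5 \<and> j = 6 \<or> i = 6 \<and> j = 5 \<or> i = 6 \<and> j = 7 \<or> i = 7 \<and> j = 6 \<or> i = 7 \<and> j = 8 \<or> i = 8 \<and> j = 7 \<or>
  i = 2 \<and> j = 4 \<or> i = 4 \<and> j = 2"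
  by (auto simp: E_edge_def doubleton_eq_iff)

lemma E_edge_simps [simp]:
  "E_edge 1 j \<longleftrightarrow> j = 3" "E_edge (Suc 0) j \<longleftrightarrow> j = 3" "E_edge 2 j \<longleftrightarrow> j = 4"
  "E_edge 3 j \<longleftrightarrow> j = 1 \<or> j = 4" "E_edge 4 j \<longleftrightarrow> j = 2 \<or> j = 3 \<or> j = 5"
  "E_edge 5 j \<longleftrightarrow> j = 4 \<or> j = 6" "E_edge 6 j \<longleftrightarrow> j = 5 \<or> j = 7"
  "E_edge 7 j \<longleftrightarrow> j = 6 \<or> j = 8" "E_edge 8 j \<longleftrightarrow> j = 7"
  by (auto simp: E_edge_cases)

lemma E_edge_branch:
  assumes "E_edge a b" "E_edge a c" "E_edge a d" "b \<noteq> c" "b \<noteq> d" "c \<noteq> d"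
  shows "a = 4"
proof -
  have "a = 1 \<or> a = 2 \<or> a = 3 \<or> a = 4 \<or> a = 5 \<or> a = 6 \<or> a = 7 \<or> a = 8"
    using assms(1) unfolding E_edge_cases by fast
  then show ?thesis using assms(2-6) assms(1) by (elim disjE) auto
qed

text \<open>The branch node 4 is fixed, being the only node with three neighbours, and so is its
  neighbour 2, being a leaf. Only the arms through 3 and 5 can be swapped, and for
  \<open>n \<ge> 7\<close> their lengths differ.\<close>

lemma diagram_automorphism:
  assumes n: "n \<in> {6, 7, 8}"
    and inj: "inj_on \<tau> {1..n}"
    and edge: "\<And>i j. i \<in> {1..n} \<Longrightarrow> j \<in> {1..n} \<Longrightarrow> E_edge i j \<Longrightarrow> E_edge (\<tau> i) (\<tau> j)"
    and range: "\<And>i. i \<in> {1..n} \<Longrightarrow> \<tau> i \<in> {1..n}"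
  shows "(\<forall>i\<in>{1..n}. \<tau> i = i) \<or> n = 6 \<and> (\<forall>i\<in>{1..n}. \<tau> i = opp_type 6 i)"
proof -
  have ne: "\<tau> i \<noteq> \<tau> j" if "i \<in> {1..n}" "j \<in> {1..n}" "i \<noteq> j" for i j
    using inj that by (simp add: inj_on_eq_iff)
  have e: "E_edge (\<tau> 4) (\<tau> 2)" "E_edge (\<tau> 4) (\<tau> 3)" "E_edge (\<tau> 4) (\<tau> 5)"
    "E_edge (\<tau> 3) (\<tau> 1)" "E_edge (\<tau> 5) (\<tau> 6)"
    by (rule edge; use n in \<open>auto simp: E_edge_cases\<close>)+
  have d: "\<tau> 2 \<noteq> \<tau> 3" "\<tau> 2 \<noteq> \<tau> 5" "\<tau> 3 \<noteq> \<tau> 5" "\<tau> 1 \<noteq> \<tau> 4" "\<tau> 6 \<noteq> \<tau> 4" "\<tau> 1 \<noteq> \<tau> 6"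
    by (rule ne; use n in auto)+
  have t4: "\<tau> 4 = 4"
    using E_edge_branch[OF e(1-3)] d by simp
  \<comment> \<open>Nodes 3 and 5 have a neighbour other than 4, hence so do their images, but node
    2 has none.\<close>
  have "\<tau> 3 \<noteq> 2" "\<tau> 5 \<noteq> 2" using e(4,5) d(4,5) t4 by auto
  moreover have "\<tau> 2 = 2 \<or> \<tau> 2 = 3 \<or> \<tau> 2 = 5" "\<tau> 3 = 2 \<or> \<tau> 3 = 3 \<or> \<tau> 3 = 5"
    "\<tau> 5 = 2 \<or> \<tau> 5 = 3 \<or> \<tau> 5 = 5" using e(1-3) t4 by simp_all
  ultimately have t2: "\<tau> 2 = 2" and t35: "\<tau> 3 = 3 \<and> \<tau> 5 = 5 \<or> \<tau> 3 = 5 \<and> \<tau> 5 = 3"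
    using d(1-3) by metis+
  have t16: "\<tau> 3 = 3 \<longrightarrow> \<tau> 1 = 1 \<and> \<tau> 6 = 6" "\<tau> 3 = 5 \<longrightarrow> \<tau> 1 = 6 \<and> \<tau> 6 = 1"
    using e(4,5) d(4,5) t35 unfolding t4 by auto
  \<comment> \<open>If the arms were swapped, \<open>\<tau> 6\<close> would be the leaf 1, whose
    only neighbour 3 is already \<open>\<tau> 5\<close>, leaving no image for 7.\<close>
  have t7: "\<tau> 3 = 3 \<and> \<tau> 7 = 7" if "n \<ge> 7"
  proof -
    have "E_edge (\<tau> 6) (\<tau> 7)" "\<tau> 7 \<noteq> \<tau> 5"
      by (rule edge ne; use n that in auto)+
    then show ?thesis using t35 t16 by auto
  qed
  have t8: "\<tau> 8 = 8" if "n = 8"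
  proof -
    have "E_edge (\<tau> 7) (\<tau> 8)" "\<tau> 8 \<noteq> \<tau> 6"
      by (rule edge ne; use n that in auto)+
    then show ?thesis using t7 t16 that by auto
  qed
  have i6: "{1..6} = {1,2,3,4,5,6::nat}" and i7: "{1..7} = {1,2,3,4,5,6,7::nat}" by auto
  consider "n = 6" | "n = 7" | "n = 8" using n by auto
  then show ?thesis
  proof cases
    case 1
    show ?thesis
    proof (cases "\<tau> 3 = 3")
      case True
      then have "\<forall>i\<in>{1..n}. \<tau> i = i" using t2 t4 t16 t35 unfolding 1 i6 by auto
      then show ?thesis ..
    next
      case False
      then have "\<forall>i\<in>{1..n}. \<tau> i = opp_type 6 i"
        using t2 t4 t16 t35 unfolding 1 i6 by (auto simp: opp_type_def)
      then show ?thesis using 1 by blast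
    qed
  next
    case 2
    have "\<forall>i\<in>{1..n}. \<tau> i = i" using 2 t2 t4 t16 t35 t7 unfolding 2 i7 by auto
    then show ?thesis ..
  next
    case 3
    have "\<forall>i\<in>{1..n}. \<tau> i = i" using 3 t2 t4 t16 t35 t7 t8 unfolding 3 interval8 by auto
    then show ?thesis ..
  qed
qed

text \<open>The vector below spans the radical of the form modulo 3 (the weight lattice of type
  $E_6$ has index 3 over the root lattice), so the Weyl group fixes it modulo 3.\<close>

lemma E6_radical_mod_3:
  defines "x \<equiv> \<lambda>k. alpha 1 k - alpha 3 k + alpha 5 k - alpha 6 k"
  assumes "set w \<subseteq> {1..6}"
  shows "\<exists>z. act 6 w x = (\<lambda>k. x k + 3 * z k)"
  using assms(2)
proof (induction w)
  case Nil
  show ?case by (intro exI[of _ "\<lambda>k. 0"]) simp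
next
  case (Cons i w)
  then have i: "i \<in> {1..6}" by simp
  obtain z where z: "act 6 w x = (\<lambda>k. x k + 3 * z k)" using Cons by auto
  have "B 6 x (alpha i) = cartan 1 i - cartan 3 i + cartan 5 i - cartan 6 i"
    using i by (simp add: x_def B_diff B_add B_alpha_alpha)
  moreover have "i = 1 \<or> i = 2 \<or> i = 3 \<or> i = 4 \<or> i = 5 \<or> i = 6" using i by auto
  ultimately have "3 dvd B 6 x (alpha i)"
    by (elim disjE) (simp_all add: cartan_def E_edge_cases)
  then obtain c where c: "B 6 x (alpha i) = 3 * c" ..
  have "act 6 (i # w) x = (\<lambda>k. refl 6 i x k + 3 * refl 6 i z k)"
    using W_lin[of "refl 6 i" 6 1 x 3 z] i by (simp add: z)
  also have "\<dots> = (\<lambda>k. x k + 3 * (refl 6 i z k - c * alpha i k))"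
    using i by (simp add: refl_eq[of i 6 x] c algebra_simps)
  finally show ?case by (intro exI[of _ "\<lambda>k. refl 6 i z k - c * alpha i k"])
qed

context type_E
begin

text \<open>Such an \<open>f\<close> would negate the radical vector \<open>x\<close>, which the
  Weyl group fixes modulo 3; the first coordinate gives \<open>-1 = 1\<close> modulo 3.\<close>

lemma minus_one_notin_W6:
  assumes "f \<in> W 6" "\<And>i. i \<in> {1..6} \<Longrightarrow> f (alpha i) = (\<lambda>k. - alpha i k)"
  shows False
proof -
  define x where "x = (\<lambda>k. alpha 1 k - alpha 3 k + alpha 5 k - alpha 6 k)"
  have s: "supported 6 x" by (auto simp: x_def supported_def alpha_def)
  obtain w where "set w \<subseteq> {1..6}" "f = act 6 w" using assms(1) by (auto simp: Wsub_def)
  then obtain z where z: "f x = (\<lambda>k. x k + 3 * z k)"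
    using E6_radical_mod_3[of w] by (auto simp: x_def)
  have "f x = (\<lambda>k. \<Sum>j\<in>{1..6}. x j * f (alpha j) k)" by (rule W_sum_alpha[OF assms(1) s])
  also have "\<dots> = (\<lambda>k. - (\<Sum>j\<in>{1..6}. x j * alpha j k))" using assms(2) by (simp add: sum_negf)
  also have "\<dots> = (\<lambda>k. - x k)" using supported_expand[OF s] by (metis (no_types))
  finally have "- x 1 = x 1 + 3 * z 1" using z by metis
  moreover have "x 1 = 1" by (simp add: x_def)
  ultimately have "3 * z 1 = -2" by simp
  then show False by presburger
qed

lemma B_nondegenerate:
  assumes u: "supported n u" and v: "supported n v"
    and eq: "\<And>i. i \<in> {1..n} \<Longrightarrow> B n u (alpha i) = B n v (alpha i)"
  shows "u = v"
proof (rule ccontr)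
  define d where "d = (\<lambda>k. u k - v k)"
  assume "u \<noteq> v"
  then have "d \<noteq> (\<lambda>k. 0)" by (auto simp: d_def fun_eq_iff)
  moreover have "supported n d" using u v by (simp add: d_def supported_diff)
  ultimately have "2 \<le> B n d d" by (simp add: B_pos)
  moreover have "B n d d = 0"
  proof (subst B_expand, rule sum.neutral, rule ballI)
    fix i assume "i \<in> {1..n}"
    then have "B n (alpha i) d = 0" using eq by (subst B_sym) (simp add: d_def B_diff)
    then show "d i * B n (alpha i) d = 0" by simp
  qed
  ultimately show False by simp
qed

lemma pos_root_nonneg: "pos_root n v \<Longrightarrow> 0 \<le> v k"
  by (simp add: pos_root_def)

lemma pos_root_height: "pos_root n v \<Longrightarrow> 1 \<le> (\<Sum>k\<in>{1..n}. v k)"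
proof -
  assume v: "pos_root n v"
  then have r: "is_root n v" by (simp add: pos_root_def)
  obtain k where "v k \<noteq> 0" using root_neq_0[OF r] by blast
  moreover have "k \<in> {1..n}"
    using r \<open>v k \<noteq> 0\<close> by (auto simp: is_root_def supported_def)
  ultimately show ?thesis
    using member_le_sum[of k "{1..n}" v] pos_root_nonneg[OF v] pos_root_nonneg[OF v, of k]
    by fastforce
qed

lemma height_1:
  assumes v: "pos_root n v" and le: "(\<Sum>k\<in>{1..n}. v k) \<le> 1"
  shows "\<exists>i\<in>{1..n}. v = alpha i"
proof -
  have r: "is_root n v" and nn: "\<And>k. 0 \<le> v k" using v by (auto simp: pos_root_def)
  obtain i where i: "v i \<noteq> 0" using root_neq_0[OF r] by blast
  have i1: "i \<in> {1..n}" using r i by (auto simp: is_root_def supported_def)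
  have sum: "(\<Sum>k\<in>{1..n}. v k) = v i + (\<Sum>k\<in>{1..n} - {i}. v k)"
    using i1 by (simp add: sum.remove)
  have vi: "v i \<ge> 1" using nn[of i] i by simp
  have "(\<Sum>k\<in>{1..n} - {i}. v k) \<ge> 0" using nn by (simp add: sum_nonneg)
  then have s0: "(\<Sum>k\<in>{1..n} - {i}. v k) = 0" and "v i = 1" using sum le vi by linarith+
  have "v k = 0" if "k \<noteq> i" for k
  proof (cases "k \<in> {1..n}")
    case True
    then show ?thesis using s0 that nn by (simp add: sum_nonneg_eq_0_iff)
  next
    case False
    then show ?thesis using r by (auto simp: is_root_def supported_def)
  qed
  then have "v = alpha i" using \<open>v i = 1\<close> by (auto simp: fun_eq_iff alpha_def)
  then show ?thesis using i1 by blast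
qed

text \<open>By maximality \<open>f\<close> and \<open>inv f\<close> turn every simple root into a
  negative root. Put \<open>v = - inv f (alpha i)\<close>. Applying \<open>f\<close> writes
  \<open>alpha i\<close> as the combination of the positive roots \<open>- f (alpha j)\<close> with
  coefficients \<open>v j\<close>. Each of them has height at least 1, so \<open>v\<close> has
  height at most 1 and is simple.\<close>

lemma longest_inv_alpha:
  assumes f: "f \<in> W n" and max: "\<forall>w\<in>W n. len n w \<le> len n f" and i: "i \<in> {1..n}"
  shows "\<exists>j\<in>{1..n}. inv f (alpha i) = (\<lambda>k. - alpha j k)"
proof -
  \<comment> \<open>Stated for every \<open>g\<close> of maximal length because it is applied both
    to \<open>f\<close> and to \<open>inv f\<close>.\<close>
  have neg: "pos_root n (\<lambda>k. - g (alpha j) k)"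
    if g: "g \<in> W n" "len n g = len n f" and j: "j \<in> {1..n}" for g j
  proof -
    have "\<not> pos_root n (g (alpha j))"
    proof
      assume "pos_root n (g (alpha j))"
      then have "len n (refl n j \<circ> inv g) = len n (inv g) + 1"
        using Wsub_inv[OF _ g(1)] g(1) j by (intro len_up) (simp_all add: W_inv_inv)
      moreover have "refl n j \<circ> inv g \<in> W n"
        using Wsub_inv[OF _ g(1)] j by (simp add: Wsub_comp)
      ultimately show False using max g by (fastforce simp: len_inv)
    qed
    moreover have "is_root n (g (alpha j))"
      using pos_root_alpha[OF j] W_root[OF g(1)] by (simp add: pos_root_def)
    ultimately show ?thesis using not_pos_root_uminus by blast
  qed
  define v where "v = (\<lambda>k. - inv f (alpha i) k)"
  have invf: "inv f \<in> W n" using Wsub_inv[OF _ f] by simp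
  have v: "pos_root n v"
    unfolding v_def by (rule neg) (simp_all only: invf len_inv[OF f] i)
  have "alpha i = (\<lambda>k. - f v k)"
    using W_inv_cancel(1)[OF f] W_uminus[OF f] by (simp add: v_def)
  also have "\<dots> = (\<lambda>k. \<Sum>j\<in>{1..n}. v j * - f (alpha j) k)"
    using v W_sum_alpha[OF f, of v] by (simp add: pos_root_def is_root_def sum_negf)
  finally have "(\<Sum>k\<in>{1..n}. alpha i k) = (\<Sum>k\<in>{1..n}. \<Sum>j\<in>{1..n}. v j * - f (alpha j) k)"
    by simp
  also have "\<dots> = (\<Sum>j\<in>{1..n}. v j * (\<Sum>k\<in>{1..n}. - f (alpha j) k))"
    by (subst sum.swap) (simp only: sum_distrib_left)
  also have "\<dots> \<ge> (\<Sum>j\<in>{1..n}. v j * 1)"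
  proof (rule sum_mono, rule mult_left_mono)
    fix j assume "j \<in> {1..n}"
    then show "1 \<le> (\<Sum>k\<in>{1..n}. - f (alpha j) k)"
      using neg[OF f refl] by (intro pos_root_height) simp
    show "0 \<le> v j" using v by (simp add: pos_root_def)
  qed
  finally have "(\<Sum>j\<in>{1..n}. v j) \<le> (\<Sum>k\<in>{1..n}. alpha i k)" by simp
  also have "\<dots> = 1" using i by (simp add: alpha_def)
  finally obtain j where "j \<in> {1..n}" "v = alpha j" using height_1[OF v] by blast
  moreover have "inv f (alpha i) = (\<lambda>k. - v k)" by (simp add: v_def)
  ultimately show ?thesis by auto
qed

lemma opp_type_range: "i \<in> {1..n} \<Longrightarrow> opp_type n i \<in> {1..n}"
  using n_cases by (auto simp: opp_type_def)

lemma opp_type_opp_type: "opp_type n (opp_type n i) = i"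
  by (simp add: opp_type_def)

lemma opp_type_p: "opp_type n p = p"
  using n_cases by (auto simp: opp_type_def pt_type_def)

text \<open>The permutation of simple roots induced by \<open>- inv f\<close> preserves the Cartan
  matrix, so it is a diagram automorphism, and the exclusion of -1 in type $E_6$ identifies it as
  \<open>opp_type\<close>. A reflection does not depend on the sign of its root, which gives the
  intertwining relation; as \<open>p\<close> is fixed, \<open>hr\<close> is negated.\<close>

lemma longest:
  assumes f: "f \<in> W n" and max: "\<forall>w\<in>W n. len n w \<le> len n f"
  shows "i \<in> {1..n} \<Longrightarrow> f \<circ> refl n (opp_type n i) = refl n i \<circ> f"
    and "f hr = (\<lambda>k. - hr k)"
proof -
  have invf: "inv f \<in> W n" using Wsub_inv[OF _ f] by simp
  obtain \<tau> where \<tau>: "\<And>i. i \<in> {1..n} \<Longrightarrow> \<tau> i \<in> {1..n} \<and> inv f (alpha i) = (\<lambda>k. - alpha (\<tau> i) k)"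
    using longest_inv_alpha[OF f max] by metis
  have cartan: "cartan (\<tau> i) (\<tau> j) = cartan i j" if "i \<in> {1..n}" "j \<in> {1..n}" for i j
  proof -
    have "B n (inv f (alpha i)) (inv f (alpha j)) = cartan (\<tau> i) (\<tau> j)"
      using \<tau>[OF that(1)] \<tau>[OF that(2)] by (simp add: B_uminus B_alpha_alpha)
    then show ?thesis using W_isometry2[OF invf] that by (simp add: B_alpha_alpha)
  qed
  have inj: "inj_on \<tau> {1..n}"
  proof (rule inj_onI)
    fix i j assume ij: "i \<in> {1..n}" "j \<in> {1..n}" "\<tau> i = \<tau> j"
    then have "cartan i j = 2" using cartan[OF ij(1,2)] by simp
    then show "i = j" by (simp add: cartan_def split: if_splits)
  qed
  have edge: "E_edge (\<tau> i) (\<tau> j)" if ij: "i \<in> {1..n}" "j \<in> {1..n}" "E_edge i j" for i j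
  proof -
    have "i \<noteq> j" using ij(3) by (auto simp: E_edge_cases)
    then have "cartan (\<tau> i) (\<tau> j) = -1" using cartan[OF ij(1,2)] ij(3) by (simp add: cartan_def)
    then show ?thesis by (simp add: cartan_def split: if_splits)
  qed
  have "\<tau> i = opp_type n i" if i: "i \<in> {1..n}" for i
  proof -
    have n6: "n \<noteq> 6" if id: "\<forall>i\<in>{1..n}. \<tau> i = i"
    proof
      assume 6: "n = 6"
      have "inv f (alpha i) = (\<lambda>k. - alpha i k)" if "i \<in> {1..6}" for i
        using \<tau>[of i] id that unfolding 6 by simp
      then show False using minus_one_notin_W6[of "inv f"] invf unfolding 6 by blast
    qed
    from diagram_automorphism[OF n_cases inj edge] \<tau>
    have "(\<forall>i\<in>{1..n}. \<tau> i = i) \<or> n = 6 \<and> (\<forall>i\<in>{1..n}. \<tau> i = opp_type 6 i)" by blast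
    then show ?thesis
    proof
      assume id: "\<forall>i\<in>{1..n}. \<tau> i = i"
      then show ?thesis using n6 i by (simp add: opp_type_def)
    next
      assume "n = 6 \<and> (\<forall>i\<in>{1..n}. \<tau> i = opp_type 6 i)"
      then show ?thesis using i by blast
    qed
  qed
  then have ia: "inv f (alpha i) = (\<lambda>k. - alpha (opp_type n i) k)" if "i \<in> {1..n}" for i
    using \<tau> that by simp
  have fa: "f (alpha (opp_type n i)) = (\<lambda>k. - alpha i k)" if "i \<in> {1..n}" for i
  proof
    fix k
    have "f (inv f (alpha i)) = (\<lambda>k. - f (alpha (opp_type n i)) k)"
      unfolding ia[OF that] by (rule W_uminus[OF f])
    from fun_cong[OF this, of k] show "f (alpha (opp_type n i)) k = - alpha i k"
      by (simp add: W_inv_cancel(1)[OF f])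
  qed
  show "f \<circ> refl n (opp_type n i) = refl n i \<circ> f" if i: "i \<in> {1..n}"
  proof
    fix v
    have "f (sroot (alpha (opp_type n i)) v) = sroot (\<lambda>k. - alpha i k) (f v)"
      using W_sroot[OF f] fa[OF i] by simp
    also have "\<dots> = sroot (alpha i) (f v)" by (simp add: sroot_def B_uminus)
    finally show "(f \<circ> refl n (opp_type n i)) v = (refl n i \<circ> f) v"
      using i opp_type_range[OF i] by (simp add: sroot_alpha)
  qed
  show "f hr = (\<lambda>k. - hr k)"
  proof (rule B_nondegenerate)
    show "supported n (f hr)" using W_supported[OF f supported_hr] .
    show "supported n (\<lambda>k. - hr k)" using supported_hr by (simp add: supported_def)
    fix i assume i: "i \<in> {1..n}"
    have "opp_type n i = p \<longleftrightarrow> i = p" using opp_type_p opp_type_opp_type by metis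
    then show "B n (f hr) (alpha i) = B n (\<lambda>k. - hr k) (alpha i)"
      using i opp_type_range[OF i] by (simp add: W_isometry[OF f] ia B_uminus hr_alpha)
  qed
qed

section \<open>Dominance and stabilizers\<close>

text \<open>The vector \<open>d = - alpha p - r\<close> vanishes at \<open>p\<close> and is
  nonnegative elsewhere because \<open>r\<close> is a negative root. Hence \<open>d\<close> and
  \<open>r\<close> have nonnegative product, which forces the product of \<open>r\<close> and
  \<open>alpha p\<close> down to -2.\<close>

lemma J_dominant_root:
  assumes r: "is_root n r" "r p = -1" and dom: "\<And>j. j \<in> J \<Longrightarrow> 0 \<le> B n r (alpha j)"
  shows "r = (\<lambda>k. - alpha p k)"
proof (rule root_product_m2[OF r(1)])
  show a: "is_root n (alpha p)" using pos_root_alpha[OF p_range] by (simp add: pos_root_def)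
  define d where "d = (\<lambda>k. - alpha p k - r k)"
  have np: "\<not> pos_root n r" using r(2) pos_root_nonneg[of r p] by auto
  have "0 \<le> B n d r"
  proof (subst B_expand, rule sum_nonneg)
    fix i assume i: "i \<in> {1..n}"
    show "0 \<le> d i * B n (alpha i) r"
    proof (cases "i = p")
      case True
      then show ?thesis using r(2) by (simp add: d_def)
    next
      case False
      then show ?thesis using not_pos_root[OF r(1) np, of i] dom[of i] i
        by (intro mult_nonneg_nonneg) (simp_all add: d_def B_sym[of n "alpha i"])
    qed
  qed
  then show "B n r (alpha p) \<le> -2"
    using r(1) by (simp add: d_def B_diff B_uminus is_root_def B_sym[of n "alpha p"])
qed

lemma refl_p_coord: "j \<in> J \<Longrightarrow> refl n j v p = v p"
  by (auto simp: refl_def)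

text \<open>The roots with coordinate -1 at \<open>p\<close> form one orbit of the parabolic
  subgroup of type \<open>J\<close>. Reflecting at a node with negative product raises the height
  and keeps the coordinate at \<open>p\<close>; negative roots have negative height, so the process
  ends at the dominant root \<open>- alpha p\<close>.\<close>

lemma J_raise:
  assumes "is_root n r" "r p = -1"
  shows "\<exists>w. set w \<subseteq> J \<and> act n w r = (\<lambda>k. - alpha p k)"
  using assms
proof (induction "nat (- (\<Sum>k\<in>{1..n}. r k))" arbitrary: r rule: less_induct)
  case less
  show ?case
  proof (cases "\<forall>j\<in>J. 0 \<le> B n r (alpha j)")
    case True
    then show ?thesis using J_dominant_root[OF less.prems] by (intro exI[of _ "[]"]) simp
  next
    case False
    then obtain j where j: "j \<in> J" "B n r (alpha j) < 0" by force
    let ?r = "refl n j r"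
    have j1: "j \<in> {1..n}" using j by simp
    have r': "is_root n ?r" "?r p = -1"
      using W_root[OF refl_in_W[OF j1]] less.prems refl_p_coord[OF j(1)] by simp_all
    have "\<not> pos_root n ?r" using r'(2) pos_root_nonneg[of ?r p] by auto
    then have "pos_root n (\<lambda>k. - ?r k)" using r'(1) not_pos_root_uminus by blast
    then have "1 \<le> (\<Sum>k\<in>{1..n}. - ?r k)" by (rule pos_root_height)
    moreover have "(\<Sum>k\<in>{1..n}. ?r k) = (\<Sum>k\<in>{1..n}. r k) - B n r (alpha j)"
    proof -
      have "(\<Sum>k\<in>{1..n}. alpha j k) = 1" using j1 by (simp add: alpha_def)
      then show ?thesis
        using j1 by (simp add: refl_eq sum_subtractf sum_distrib_left[symmetric])
    qed
    ultimately have "nat (- (\<Sum>k\<in>{1..n}. ?r k)) < nat (- (\<Sum>k\<in>{1..n}. r k))"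
      using j(2) by (simp add: sum_negf)
    then obtain w where "set w \<subseteq> J" "act n w ?r = (\<lambda>k. - alpha p k)"
      using less.hyps[OF _ r'] by blast
    then show ?thesis using j(1) by (intro exI[of _ "w @ [j]"]) (simp add: act_append)
  qed
qed

text \<open>Minimality refers to words over \<open>K\<close>, which avoids comparing the length
  inside a parabolic subgroup with \<open>len\<close>.\<close>

definition reduced :: "nat set \<Rightarrow> nat list \<Rightarrow> bool" where
  "reduced K w \<longleftrightarrow> set w \<subseteq> K \<and> (\<forall>w'. set w' \<subseteq> K \<longrightarrow> act n w' = act n w \<longrightarrow> length w \<le> length w')"

lemma reduced_exists:
  assumes "f \<in> Wsub n K"
  obtains w where "reduced K w" "act n w = f"
proof -
  obtain w where "set w \<subseteq> K \<and> act n w = f" using assms by (auto simp: Wsub_def)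
  from ex_has_least_nat[of "\<lambda>w. set w \<subseteq> K \<and> act n w = f" w length, OF this]
  show ?thesis using that unfolding reduced_def by metis
qed

lemma reduced_tl: "reduced K (i # w) \<Longrightarrow> reduced K w"
  unfolding reduced_def
proof (elim conjE, intro conjI allI impI)
  fix w' assume min: "\<forall>w'. set w' \<subseteq> K \<longrightarrow> act n w' = act n (i # w) \<longrightarrow> length (i # w) \<le> length w'"
    and "set (i # w) \<subseteq> K" "set w' \<subseteq> K" "act n w' = act n w"
  then have "length (i # w) \<le> length (i # w')" by (intro min[rule_format]) auto
  then show "length w \<le> length w'" by simp
qed simp

text \<open>Unless \<open>act n (rev w) (alpha j)\<close> is positive, the exchange condition
  shortens \<open>j # w\<close>. This root is supported on \<open>K\<close>, where \<open>u\<close>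
  has nonnegative products, and isometry moves the word to the other side.\<close>

lemma reduced_dominant_step:
  assumes K: "K \<subseteq> {1..n}" and w: "reduced K (j # w)"
    and dom: "\<And>i. i \<in> K \<Longrightarrow> 0 \<le> B n u (alpha i)"
  shows "0 \<le> B n (act n w u) (alpha j)"
proof -
  have j: "j \<in> K" "j \<in> {1..n}" and wK: "set w \<subseteq> K" and wn: "set w \<subseteq> {1..n}"
    using w K by (auto simp: reduced_def)
  define b where "b = act n (rev w) (alpha j)"
  have "pos_root n b"
  proof (rule ccontr)
    assume "\<not> pos_root n b"
    then obtain w' where "set w' \<subseteq> set w" "length w' < length w" "act n w' = act n (j # w)"
      using exchange[OF wn j(2)] by (auto simp: b_def)
    then show False using w wK unfolding reduced_def by (metis Suc_lessD length_Cons not_le subset_trans less_SucI)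
  qed
  moreover have "b k = 0" if "k \<notin> K" for k
    unfolding b_def using that j wK by (subst act_unchanged) (auto simp: alpha_def)
  ultimately have "0 \<le> b k * B n (alpha k) u" for k
    using dom[of k] by (cases "k \<in> K") (simp_all add: pos_root_def B_sym[of n "alpha k"])
  then have "0 \<le> B n b u" by (subst B_expand) (simp add: sum_nonneg)
  then show ?thesis using act_isometry[OF wn] by (simp add: b_def B_sym[of n u])
qed

text \<open>Each letter subtracts a nonnegative multiple of a simple root, so coordinates never
  increase along the word. If \<open>u\<close> is recovered at the end, every subtracted multiple is
  0 and every letter is orthogonal to \<open>u\<close>.\<close>

lemma reduced_stabilizer:
  assumes K: "K \<subseteq> {1..n}" and w: "reduced K w"
    and dom: "\<And>i. i \<in> K \<Longrightarrow> 0 \<le> B n u (alpha i)" and fixes_u: "act n w u = u"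
  shows "set w \<subseteq> {i \<in> K. B n u (alpha i) = 0}"
proof -
  have "(\<forall>k. act n w u k \<le> u k) \<and> (act n w u = u \<longrightarrow> set w \<subseteq> {i \<in> K. B n u (alpha i) = 0})"
    using w
  proof (induction w)
    case Nil
    then show ?case by simp
  next
    case (Cons j w)
    have j: "j \<in> K" "j \<in> {1..n}" using Cons.prems K by (auto simp: reduced_def)
    note IH = Cons.IH[OF reduced_tl[OF Cons.prems]]
    have nn: "0 \<le> B n (act n w u) (alpha j)" by (rule reduced_dominant_step[OF K Cons.prems dom])
    have eq: "act n (j # w) u k = act n w u k - B n (act n w u) (alpha j) * alpha j k" for k
      using j(2) by (simp add: refl_eq)
    have le: "act n (j # w) u k \<le> act n w u k" for k
      using nn unfolding eq by (simp add: alpha_def)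
    show ?case
    proof (intro conjI allI impI)
      show "act n (j # w) u k \<le> u k" for k using le IH order_trans by blast
      assume fixes_u: "act n (j # w) u = u"
      then have "act n w u = u" using le IH by (intro ext order_antisym) metis+
      moreover from this have "B n u (alpha j) = 0" using eq[of j] fixes_u by simp
      ultimately show "set (j # w) \<subseteq> {i \<in> K. B n u (alpha i) = 0}" using IH j(1) by simp
    qed
  qed
  then show ?thesis using fixes_u by blast
qed

lemma stabilizer_hr:
  assumes "f \<in> W n" "f hr = hr"
  shows "f \<in> Wsub n J"
proof -
  obtain w where w: "reduced {1..n} w" "act n w = f" using reduced_exists[OF assms(1)] .
  have "set w \<subseteq> {i \<in> {1..n}. B n hr (alpha i) = 0}"
    using w assms(2) by (intro reduced_stabilizer) (simp_all add: hr_alpha)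
  also have "\<dots> \<subseteq> J" using hr_alpha by force
  finally show ?thesis using w(2) by (auto simp: Wsub_def)
qed

end

section \<open>Walks in the Dynkin diagram\<close>

lemma E_edge_irrefl: "\<not> E_edge i i"
  by (simp add: E_edge_def doubleton_eq_iff)

fun induced_path :: "nat list \<Rightarrow> bool" where
  "induced_path [] \<longleftrightarrow> False"
| "induced_path [a] \<longleftrightarrow> True"
| "induced_path (a # b # l) \<longleftrightarrow>
     E_edge a b \<and> (\<forall>c\<in>set l. a \<noteq> c \<and> \<not> E_edge a c) \<and> induced_path (b # l)"

context type_E
begin

text \<open>The diagram is a tree; for each of the three types the paths from the polar node are
  listed explicitly.\<close>

lemma path_from_p:
  assumes "i \<in> {1..n}"
  shows "\<exists>l. induced_path l \<and> hd l = p \<and> last l = i \<and> set l \<subseteq> {1..n}"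
proof -
  have paths: "\<forall>l\<in>set ls. induced_path l \<and> hd l = p \<and> set l \<subseteq> {1..n} \<Longrightarrow> i \<in> set (map last ls)
    \<Longrightarrow> \<exists>l. induced_path l \<and> hd l = p \<and> last l = i \<and> set l \<subseteq> {1..n}" for ls
    by auto
  consider "n = 6" | "n = 7" | "n = 8" using n_cases by auto
  then show ?thesis
  proof cases
    case 1
    moreover from 1 have "i = 1 \<or> i = 2 \<or> i = 3 \<or> i = 4 \<or> i = 5 \<or> i = 6" using assms by auto
    ultimately show ?thesis
      by (intro paths[of "[[2], [2,4], [2,4,3], [2,4,3,1], [2,4,5], [2,4,5,6]]"])
        (auto simp: pt_type_def)
  next
    case 2
    moreover from 2 have "i = 1 \<or> i = 2 \<or> i = 3 \<or> i = 4 \<or> i = 5 \<or> i = 6 \<or> i = 7" using assms by auto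
    ultimately show ?thesis
      by (intro paths[of "[[1], [1,3], [1,3,4], [1,3,4,2], [1,3,4,5], [1,3,4,5,6], [1,3,4,5,6,7]]"])
        (auto simp: pt_type_def)
  next
    case 3
    moreover from 3 have "i = 1 \<or> i = 2 \<or> i = 3 \<or> i = 4 \<or> i = 5 \<or> i = 6 \<or> i = 7 \<or> i = 8"
      using assms by auto
    ultimately show ?thesis
      by (intro paths[of "[[8], [8,7], [8,7,6], [8,7,6,5], [8,7,6,5,4], [8,7,6,5,4,2],
        [8,7,6,5,4,3], [8,7,6,5,4,3,1]]"])
        (auto simp: pt_type_def)
  qed
qed

text \<open>The vector is arbitrary, not just the highest root, because conjugating by the next reflection
  of the path replaces it by its mirror image.\<close>

definition lowers :: "nat list \<Rightarrow> weyl \<Rightarrow> bool" where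
  "lowers l u \<longleftrightarrow> u \<in> Wsub n (set l) \<and>
     (\<forall>v. B n v (alpha (hd l)) = 1 \<longrightarrow> (\<forall>c\<in>set (tl l). B n v (alpha c) = 0) \<longrightarrow>
        B n (u v) v = B n v v - 1)"

lemma lowers_refl: "i \<in> {1..n} \<Longrightarrow> lowers [i] (refl n i)"
  by (simp add: lowers_def refl_eq B_diff B_scale B_sym[of n "alpha i"])

lemma Wsub_fixes:
  assumes "u \<in> Wsub n K" "K \<subseteq> {1..n}" "\<And>c. c \<in> K \<Longrightarrow> B n v (alpha c) = 0"
  shows "u v = v"
proof -
  obtain w where "u = act n w" "set w \<subseteq> K" using assms(1) by (auto simp: Wsub_def)
  moreover have "act n w v = v" if "set w \<subseteq> K" for w
    using that assms(2,3) by (induction w) (auto simp: refl_eq subset_iff)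
  ultimately show ?thesis by simp
qed

text \<open>Without conjugation, \<open>u\<close> fixes \<open>v\<close> and the reflection at
  \<open>a\<close> lowers the product by 1. With conjugation, \<open>x = refl n a v\<close> takes
  the place of \<open>v\<close>: it has product 1 with \<open>alpha b\<close> and, since the path
  has no chords, 0 with the later nodes, so the hypothesis on \<open>u\<close> applies to
  \<open>x\<close>.\<close>

lemma lowers_Cons:
  assumes u: "lowers (b # l) u" and path: "induced_path (a # b # l)"
    and range: "set (a # b # l) \<subseteq> {1..n}" and u': "u' = refl n a \<circ> u \<or> u' = refl n a \<circ> u \<circ> refl n a"
  shows "lowers (a # b # l) u'"
  unfolding lowers_def
proof (intro conjI allI impI)
  have a: "a \<in> {1..n}" and uW: "u \<in> Wsub n (set (b # l))" using u range by (simp_all add: lowers_def)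
  then have "u \<in> Wsub n (set (a # b # l))"
    using Wsub_mono[of "set (b # l)" "set (a # b # l)"] by auto
  then show "u' \<in> Wsub n (set (a # b # l))" using u' by (auto intro!: Wsub_comp)
  fix v
  assume "B n v (alpha (hd (a # b # l))) = 1" "\<forall>c\<in>set (tl (a # b # l)). B n v (alpha c) = 0"
  then have va: "B n v (alpha a) = 1" and v0: "\<And>c. c \<in> set (b # l) \<Longrightarrow> B n v (alpha c) = 0"
    by auto
  have low: "B n (refl n a v) v = B n v v - 1"
    using va a by (simp add: refl_eq B_diff B_scale B_sym[of n "alpha a"])
  show "B n (u' v) v = B n v v - 1"
    using u'
  proof
    assume "u' = refl n a \<circ> u"
    moreover have "u v = v" using Wsub_fixes[OF uW] range v0 by auto
    ultimately show ?thesis using low by simp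
  next
    assume u'': "u' = refl n a \<circ> u \<circ> refl n a"
    define x where "x = refl n a v"
    have x: "B n x (alpha c) = B n v (alpha c) - cartan a c" if "c \<in> {1..n}" for c
      using a that va by (simp add: x_def refl_eq B_diff B_scale B_alpha_alpha)
    have "E_edge a b" "a \<noteq> b" using path E_edge_irrefl by auto
    then have "B n x (alpha b) = 1" using x[of b] v0[of b] range by (simp add: cartan_def)
    moreover have "B n x (alpha c) = 0" if "c \<in> set l" for c
      using x[of c] v0[of c] path range that by (auto simp: cartan_def)
    ultimately have "B n (u x) x = B n x x - 1" using u by (simp add: lowers_def)
    moreover have "B n x x = B n v v" using W_isometry2[OF refl_in_W[OF a]] by (simp add: x_def)
    moreover have "B n (u' v) v = B n (u x) x" by (simp add: u'' x_def refl_isometry[OF a])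
    ultimately show ?thesis by simp
  qed
qed

end

section \<open>Buildings and points\<close>

locale building_E = type_E n for n :: nat +
  fixes Ch :: "'c set" and \<delta> :: "'c \<Rightarrow> 'c \<Rightarrow> weyl"
  assumes building: "thick_building n Ch \<delta>"
begin

lemma delta_W: "C \<in> Ch \<Longrightarrow> D \<in> Ch \<Longrightarrow> \<delta> C D \<in> W n"
  using building unfolding thick_building_def by (elim conjE) blast

lemma delta_id: "C \<in> Ch \<Longrightarrow> D \<in> Ch \<Longrightarrow> \<delta> C D = id \<longleftrightarrow> C = D"
  using building unfolding thick_building_def by (elim conjE) blast

lemma delta_step:
  assumes "C \<in> Ch" "D \<in> Ch" "C' \<in> Ch" "s \<in> {1..n}" "\<delta> C' C = refl n s"
  shows "\<delta> C' D = refl n s \<circ> \<delta> C D \<or> \<delta> C' D = \<delta> C D"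
    and "len n (refl n s \<circ> \<delta> C D) = len n (\<delta> C D) + 1 \<Longrightarrow> \<delta> C' D = refl n s \<circ> \<delta> C D"
  using building assms unfolding thick_building_def by (elim conjE; blast)+

lemma delta_exists:
  assumes "C \<in> Ch" "D \<in> Ch" "s \<in> {1..n}"
  obtains C' where "C' \<in> Ch" "\<delta> C' C = refl n s" "\<delta> C' D = refl n s \<circ> \<delta> C D"
  using building assms unfolding thick_building_def by (elim conjE) blast

text \<open>The step axiom towards \<open>C\<close> itself leaves only
  \<open>id = refl n s \<circ> \<delta> D C\<close>, since \<open>C\<close> and \<open>D\<close> are
  distinct.\<close>

lemma adjacent_sym:
  assumes "C \<in> Ch" "D \<in> Ch" "s \<in> {1..n}" "\<delta> C D = refl n s"
  shows "\<delta> D C = refl n s"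
proof -
  have "\<delta> C C = refl n s \<circ> \<delta> D C \<or> \<delta> C C = \<delta> D C"
    by (rule delta_step(1)) (use assms in simp_all)
  moreover have "\<delta> C C = id" using delta_id assms(1) by blast
  moreover have "\<delta> D C \<noteq> id"
    using delta_id[OF assms(2,1)] delta_id[OF assms(1,2)] refl_neq_id[OF assms(3)] assms(4) by auto
  ultimately have eq: "refl n s \<circ> \<delta> D C = id" by auto
  have "\<delta> D C = (refl n s \<circ> refl n s) \<circ> \<delta> D C" using assms(3) by simp
  also have "\<dots> = refl n s" by (simp only: comp_assoc eq) simp
  finally show ?thesis .
qed

section \<open>Galleries and inversion of the distance\<close>

fun gallery :: "nat list \<Rightarrow> 'c \<Rightarrow> 'c \<Rightarrow> bool" where
  "gallery [] C D \<longleftrightarrow> C = D"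
| "gallery (s # w) C D \<longleftrightarrow> (\<exists>E\<in>Ch. \<delta> C E = refl n s \<and> gallery w E D)"

lemma gallery_exists:
  "C \<in> Ch \<Longrightarrow> D \<in> Ch \<Longrightarrow> set w \<subseteq> {1..n} \<Longrightarrow> \<delta> C D = act n w \<Longrightarrow> gallery w C D"
proof (induction w arbitrary: C)
  case Nil
  then show ?case using delta_id[of C D] by (simp add: id_def)
next
  case (Cons s w)
  then have s: "s \<in> {1..n}" by simp
  obtain C' where C': "C' \<in> Ch" "\<delta> C' C = refl n s" "\<delta> C' D = refl n s \<circ> \<delta> C D"
    using delta_exists[OF Cons.prems(1,2) s] .
  have "\<delta> C' D = (refl n s \<circ> refl n s) \<circ> act n w"
    unfolding C'(3) Cons.prems(4) by (simp only: act.simps comp_assoc)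
  then have "\<delta> C' D = act n w" using s by simp
  then have "gallery w C' D" using Cons C' by simp
  moreover have "\<delta> C C' = refl n s" using adjacent_sym C' Cons.prems(1) s by blast
  ultimately show ?case using C' by auto
qed

lemma gallery_Wsub:
  assumes "K \<subseteq> {1..n}"
  shows "C \<in> Ch \<Longrightarrow> D \<in> Ch \<Longrightarrow> set w \<subseteq> K \<Longrightarrow> gallery w C D \<Longrightarrow> \<delta> C D \<in> Wsub n K"
proof (induction w arbitrary: C)
  case Nil
  then show ?case using delta_id[of C D] Wsub_id[of n K] by (simp add: id_def)
next
  case (Cons s w)
  then obtain E where E: "E \<in> Ch" "\<delta> C E = refl n s" "gallery w E D" by auto
  have s: "s \<in> K" using Cons.prems(3) by simp
  then have "\<delta> C D = refl n s \<circ> \<delta> E D \<or> \<delta> C D = \<delta> E D"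
    using delta_step(1)[of E D C s] E Cons.prems(1,2) assms by auto
  moreover have "\<delta> E D \<in> Wsub n K" using Cons E by simp
  ultimately show ?case using Wsub_comp[OF Wsub_refl[OF s]] by metis
qed

lemma gallery_append: "C \<in> Ch \<Longrightarrow> gallery (v @ w) C D \<longleftrightarrow> (\<exists>E\<in>Ch. gallery v C E \<and> gallery w E D)"
  by (induction v arbitrary: C) auto

lemma gallery_rev:
  "C \<in> Ch \<Longrightarrow> D \<in> Ch \<Longrightarrow> set w \<subseteq> {1..n} \<Longrightarrow> gallery w C D \<Longrightarrow> gallery (rev w) D C"
proof (induction w arbitrary: C)
  case Nil
  then show ?case by simp
next
  case (Cons s w)
  then obtain E where E: "E \<in> Ch" "\<delta> C E = refl n s" "gallery w E D" by auto
  then have "gallery (rev w) D E" "\<delta> E C = refl n s" using Cons adjacent_sym[of C E s] by auto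
  then show ?case using E Cons.prems(1,2) by (auto simp: gallery_append)
qed

lemma len_reduced: "reduced {1..n} w \<Longrightarrow> len n (act n w) = length w"
proof -
  assume w: "reduced {1..n} w"
  then have "act n w \<in> W n" by (auto simp: reduced_def Wsub_def)
  then obtain v where "set v \<subseteq> {1..n}" "act n v = act n w" "length v = len n (act n w)"
    using reduced_word by blast
  then show ?thesis using w len_act[of w] by (force simp: reduced_def)
qed

text \<open>Every step, read from the end of the gallery, increases the length, so the step axiom
  leaves no choice.\<close>

lemma gallery_reduced:
  "C \<in> Ch \<Longrightarrow> D \<in> Ch \<Longrightarrow> reduced {1..n} w \<Longrightarrow> gallery w C D \<Longrightarrow> \<delta> C D = act n w"
proof (induction w arbitrary: C)
  case Nil
  then show ?case using delta_id[of C D] by (simp add: id_def)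
next
  case (Cons s w)
  then obtain E where E: "E \<in> Ch" "\<delta> C E = refl n s" "gallery w E D" by auto
  have w: "reduced {1..n} w" using reduced_tl Cons.prems(3) by blast
  have IH: "\<delta> E D = act n w" using Cons E w by blast
  have s: "s \<in> {1..n}" using Cons.prems(3) by (simp add: reduced_def)
  have "len n (refl n s \<circ> \<delta> E D) = len n (\<delta> E D) + 1"
    using len_reduced[OF w] len_reduced[OF Cons.prems(3)] by (simp add: IH)
  then have "\<delta> C D = refl n s \<circ> \<delta> E D"
    using delta_step(2)[OF E(1) Cons.prems(2,1) s E(2)] by simp
  then show ?case by (simp add: IH)
qed

lemma reduced_rev:
  assumes w: "reduced {1..n} w"
  shows "reduced {1..n} (rev w)"
  unfolding reduced_def
proof (intro conjI allI impI)
  show "set (rev w) \<subseteq> {1..n}" using w by (simp add: reduced_def)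
  fix w' assume w': "set w' \<subseteq> {1..n}" "act n w' = act n (rev w)"
  then have "act n (rev w') = act n w"
    using inv_act[of w' n] inv_act[of "rev w" n] w by (simp add: reduced_def)
  then have "length w \<le> length (rev w')" using w w'(1) unfolding reduced_def by (metis set_rev)
  then show "length (rev w) \<le> length w'" by simp
qed

text \<open>A gallery of reduced type from \<open>C\<close> to \<open>D\<close>, read backwards, has
  the reversed type, which is again reduced and therefore determines the distance.\<close>

lemma delta_inv:
  assumes "C \<in> Ch" "D \<in> Ch"
  shows "\<delta> D C = inv (\<delta> C D)"
proof -
  obtain w where w: "reduced {1..n} w" "act n w = \<delta> C D"
    using reduced_exists[OF delta_W[OF assms]] .
  then have wn: "set w \<subseteq> {1..n}" by (simp add: reduced_def)
  have "gallery w C D" using gallery_exists[OF assms wn] w(2) by simp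
  then have "gallery (rev w) D C" by (rule gallery_rev[OF assms wn])
  then have "\<delta> D C = act n (rev w)" using gallery_reduced reduced_rev w(1) assms by blast
  then show ?thesis using inv_act[OF wn] w(2) by simp
qed

text \<open>The building axioms move only the first chamber; inversion transfers the step to the
  second.\<close>

lemma delta_step_right:
  assumes "C \<in> Ch" "D \<in> Ch" "D' \<in> Ch" "t \<in> {1..n}" "\<delta> D D' = refl n t"
  shows "\<delta> C D' = \<delta> C D \<circ> refl n t \<or> \<delta> C D' = \<delta> C D"
proof -
  have "\<delta> D' D = refl n t" using adjacent_sym assms by blast
  then have "\<delta> D' C = refl n t \<circ> \<delta> D C \<or> \<delta> D' C = \<delta> D C"
    using delta_step(1) assms by blast
  then show ?thesis
    using inv_refl_comp[OF delta_W[OF assms(2,1)] assms(4)] delta_inv assms(1-3) by metis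
qed

section \<open>Points as residues\<close>

abbreviation resJ :: "'c \<Rightarrow> 'c set" where
  "resJ \<equiv> res n J Ch \<delta>"

lemma J_subset: "J \<subseteq> {1..n}" by blast

lemma resJ_gallery:
  assumes "C \<in> Ch"
  shows "D \<in> resJ C \<longleftrightarrow> D \<in> Ch \<and> (\<exists>w. set w \<subseteq> J \<and> gallery w C D)"
proof
  assume "D \<in> resJ C"
  then obtain w where w: "D \<in> Ch" "set w \<subseteq> J" "\<delta> C D = act n w" by (auto simp: res_def Wsub_def)
  then have "gallery w C D" using gallery_exists[OF assms w(1)] by (meson J_subset subset_trans)
  then show "D \<in> Ch \<and> (\<exists>w. set w \<subseteq> J \<and> gallery w C D)" using w by blast
next
  assume "D \<in> Ch \<and> (\<exists>w. set w \<subseteq> J \<and> gallery w C D)"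
  then show "D \<in> resJ C" using gallery_Wsub[OF J_subset assms] by (auto simp: res_def)
qed

lemma resJ_Ch: "D \<in> resJ C \<Longrightarrow> D \<in> Ch"
  by (simp add: res_def)

lemma resJ_self: "C \<in> Ch \<Longrightarrow> C \<in> resJ C"
  using delta_id[of C C] by (simp add: res_def)

lemma resJ_sym:
  assumes "C \<in> Ch" "D \<in> resJ C"
  shows "C \<in> resJ D"
proof -
  have "D \<in> Ch" "\<delta> C D \<in> Wsub n J" using assms(2) by (simp_all add: res_def)
  then show ?thesis
    using delta_inv[OF assms(1)] Wsub_inv[OF J_subset] assms(1) by (simp add: res_def)
qed

lemma resJ_trans:
  assumes "C \<in> Ch" "D \<in> resJ C" "E \<in> resJ D"
  shows "E \<in> resJ C"
proof -
  have D: "D \<in> Ch" using assms by (simp add: res_def)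
  obtain v w where "set v \<subseteq> J" "gallery v C D" "set w \<subseteq> J" "gallery w D E" "E \<in> Ch"
    using assms resJ_gallery[OF assms(1)] resJ_gallery[OF D] by auto
  then have "set (v @ w) \<subseteq> J" "gallery (v @ w) C E" "E \<in> Ch"
    using D gallery_append[OF assms(1)] by auto
  then show ?thesis using resJ_gallery[OF assms(1)] by blast
qed

lemma resJ_eq: "C \<in> Ch \<Longrightarrow> D \<in> resJ C \<Longrightarrow> resJ D = resJ C"
  using resJ_sym resJ_trans resJ_Ch by blast

lemma resJ_adjacent:
  assumes "C \<in> Ch" "D \<in> Ch" "j \<in> J" "\<delta> C D = refl n j"
  shows "D \<in> resJ C"
  using assms by (simp add: res_def)

text \<open>The existence axiom supplies, letter by letter, a neighbour with the prescribed
  distance, so every element of the parabolic subgroup can be realised by moving inside the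
  point.\<close>

lemma resJ_move:
  assumes "C \<in> Ch" "D \<in> Ch" "set w \<subseteq> J"
  shows "\<exists>C'\<in>resJ C. \<delta> C' D = act n w \<circ> \<delta> C D"
  using assms(3)
proof (induction w)
  case Nil
  then show ?case using resJ_self[OF assms(1)] by auto
next
  case (Cons j w)
  then obtain E where E: "E \<in> resJ C" "\<delta> E D = act n w \<circ> \<delta> C D" by (auto simp del: comp_apply)
  have j: "j \<in> J" "j \<in> {1..n}" using Cons.prems by auto
  have ECh: "E \<in> Ch" using E(1) by (rule resJ_Ch)
  obtain C' where C': "C' \<in> Ch" "\<delta> C' E = refl n j" "\<delta> C' D = refl n j \<circ> \<delta> E D"
    using delta_exists[OF ECh assms(2) j(2)] .
  have "C' \<in> resJ E" using resJ_adjacent[OF ECh C'(1) j(1)] adjacent_sym C' ECh j(2) by blast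
  then have "C' \<in> resJ C" using resJ_trans assms(1) E(1) by blast
  moreover have "\<delta> C' D = act n (j # w) \<circ> \<delta> C D" using C'(3) E(2) by (simp add: comp_assoc)
  ultimately show ?case by blast
qed

text \<open>This root depends only on \<open>C\<close> and the point of \<open>D\<close>, and its
  coordinate at \<open>p\<close> only on the points of \<open>C\<close> and
  \<open>D\<close>.\<close>

definition hr_image :: "'c \<Rightarrow> 'c \<Rightarrow> nat \<Rightarrow> int" where
  "hr_image C D = \<delta> C D hr"

lemma hr_image_root: "C \<in> Ch \<Longrightarrow> D \<in> Ch \<Longrightarrow> is_root n (hr_image C D)"
  unfolding hr_image_def using W_root delta_W root_hr by blast

lemma hr_image_step:
  assumes "C \<in> Ch" "D \<in> Ch" "C' \<in> Ch" "j \<in> {1..n}" "\<delta> C' C = refl n j"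
  shows "hr_image C' D = refl n j (hr_image C D) \<or> hr_image C' D = hr_image C D"
  using delta_step(1)[OF assms] by (auto simp: hr_image_def)

text \<open>For product 0 both outcomes of the step coincide. For positive product,
  \<open>inv (\<delta> C D) (alpha j)\<close> has positive coordinate at \<open>p\<close>, so it is
  a positive root, the length increases and the step is forced.\<close>

lemma hr_image_step_pos:
  assumes C: "C \<in> Ch" "D \<in> Ch" "C' \<in> Ch" "j \<in> {1..n}" "\<delta> C' C = refl n j"
    and nn: "0 \<le> B n (hr_image C D) (alpha j)"
  shows "hr_image C' D = refl n j (hr_image C D)"
proof (cases "B n (hr_image C D) (alpha j) = 0")
  case True
  then show ?thesis using hr_image_step[OF C] by (simp add: refl_eq[OF C(4)])
next
  case False
  have f: "\<delta> C D \<in> W n" using delta_W C(1,2) .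
  then have inv: "inv (\<delta> C D) \<in> W n" using Wsub_inv by blast
  have "B n (hr_image C D) (alpha j) = inv (\<delta> C D) (alpha j) p"
    by (simp add: hr_image_def W_isometry[OF f] B_hr)
  then have "0 < inv (\<delta> C D) (alpha j) p" using False nn by simp
  moreover have "is_root n (inv (\<delta> C D) (alpha j))"
    using W_root[OF inv] pos_root_alpha[OF C(4)] by (simp add: pos_root_def)
  ultimately have "pos_root n (inv (\<delta> C D) (alpha j))" using pos_rootI by blast
  then have "len n (refl n j \<circ> \<delta> C D) = len n (\<delta> C D) + 1" by (rule len_up[OF f C(4)])
  then have "\<delta> C' D = refl n j \<circ> \<delta> C D" by (rule delta_step(2)[OF C])
  then show ?thesis by (simp add: hr_image_def)
qed

text \<open>Steps inside the point of \<open>D\<close> multiply, if at all, on the right by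
  reflections that fix \<open>hr\<close>.\<close>

lemma hr_image_right:
  assumes "C \<in> Ch" "D \<in> Ch" "D' \<in> resJ D"
  shows "hr_image C D' = hr_image C D"
proof -
  have "gallery w D D' \<Longrightarrow> set w \<subseteq> J \<Longrightarrow> D \<in> Ch \<Longrightarrow> D' \<in> Ch \<Longrightarrow> hr_image C D' = hr_image C D" for w D
  proof (induction w arbitrary: D)
    case Nil
    then show ?case by simp
  next
    case (Cons j w)
    then obtain E where E: "E \<in> Ch" "\<delta> D E = refl n j" "gallery w E D'" by auto
    have j: "j \<in> J" "j \<in> {1..n}" using Cons.prems by auto
    have "hr_image C E = hr_image C D"
      using delta_step_right[OF assms(1) Cons.prems(3) E(1) j(2) E(2)] refl_hr[OF j(1)]
      by (auto simp: hr_image_def)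
    then show ?case using Cons E by simp
  qed
  then show ?thesis using assms resJ_gallery[OF assms(2)] by blast
qed

text \<open>Steps inside the point of \<open>C\<close> act, if at all, on the left by reflections
  that leave coordinate \<open>p\<close> unchanged.\<close>

lemma hr_image_left_p:
  assumes "C \<in> Ch" "D \<in> Ch" "C' \<in> resJ C"
  shows "hr_image C' D p = hr_image C D p"
proof -
  have "gallery w C C' \<Longrightarrow> set w \<subseteq> J \<Longrightarrow> C \<in> Ch \<Longrightarrow> C' \<in> Ch \<Longrightarrow> hr_image C' D p = hr_image C D p" for w C
  proof (induction w arbitrary: C)
    case Nil
    then show ?case by simp
  next
    case (Cons j w)
    then obtain E where E: "E \<in> Ch" "\<delta> C E = refl n j" "gallery w E C'" by auto
    have j: "j \<in> J" "j \<in> {1..n}" using Cons.prems by auto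
    have "hr_image C D p = hr_image E D p"
      using hr_image_step[OF E(1) assms(2) Cons.prems(3) j(2) E(2)] refl_p_coord[OF j(1)] by auto
    then show ?case using Cons E by simp
  qed
  then show ?thesis using assms resJ_gallery[OF assms(1)] by blast
qed

lemma hr_image_self: "C \<in> Ch \<Longrightarrow> D \<in> resJ C \<Longrightarrow> hr_image C D p = 2"
  using hr_image_right[of C C D] delta_id[of C C] by (simp add: hr_image_def hr_p)

lemma hr_image_resJ:
  assumes "C \<in> Ch" "D \<in> Ch" "C' \<in> resJ C" "D' \<in> resJ D"
  shows "hr_image C' D' p = hr_image C D p"
  using hr_image_left_p[OF assms(1-3)] hr_image_right[OF resJ_Ch[OF assms(3)] assms(2,4)] by simp

lemma hr_image_adjacent_p: "\<delta> C D = refl n p \<Longrightarrow> hr_image C D p = 1"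
  by (simp add: hr_image_def refl_p_hr hr_p)

text \<open>For the converse, moving \<open>C\<close> inside its point makes the root equal to
  \<open>refl n p hr\<close>. One further step of type \<open>p\<close> then reaches a chamber whose
  distance to \<open>D\<close> fixes \<open>hr\<close>, that is, a chamber of the point of
  \<open>D\<close>.\<close>

lemma collinear_iff:
  assumes C: "C \<in> Ch" and D: "D \<in> Ch"
  shows "collinear n \<delta> (resJ C) (resJ D) \<longleftrightarrow> hr_image C D p = 1"
proof
  assume "collinear n \<delta> (resJ C) (resJ D)"
  then obtain C' D' where "C' \<in> resJ C" "D' \<in> resJ D" "\<delta> C' D' = refl n p"
    by (auto simp: collinear_def)
  then show "hr_image C D p = 1" using hr_image_resJ[OF C D] hr_image_adjacent_p by metis
next
  assume 1: "hr_image C D p = 1"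
  \<comment> \<open>The difference of two roots with product 1 is again a root, and its coordinate
    at \<open>p\<close> is \<open>1 - 2 = -1\<close>, as \<open>J_raise\<close> requires.\<close>
  define r where "r = (\<lambda>k. hr_image C D k - hr k)"
  have rt: "is_root n (hr_image C D)" using C D by (rule hr_image_root)
  have "is_root n r"
    unfolding is_root_def
  proof
    show "supported n r"
      using rt supported_hr by (simp add: r_def is_root_def supported_diff)
    show "B n r r = 2"
      using rt 1 by (simp add: r_def B_diff B_hr B_sym[of n "hr_image C D" hr] is_root_def hr_p)
  qed
  moreover have "r p = -1" using 1 by (simp add: r_def hr_p)
  ultimately obtain w where w: "set w \<subseteq> J" "act n w r = (\<lambda>k. - alpha p k)"
    using J_raise by blast
  have wW: "act n w \<in> Wsub n J" "act n w \<in> W n" using w(1) by (auto simp: Wsub_def)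
  have fix_hr: "act n w hr = hr"
    using Wsub_fixes[OF wW(1) J_subset] hr_alpha by simp
  obtain C' where C': "C' \<in> resJ C" "\<delta> C' D = act n w \<circ> \<delta> C D"
    using resJ_move[OF C D w(1)] by blast
  have C'Ch: "C' \<in> Ch" using C'(1) by (rule resJ_Ch)
  have "(\<lambda>k. - alpha p k) = (\<lambda>k. act n w (hr_image C D) k - hr k)"
    using w(2) W_diff[OF wW(2), of "hr_image C D" hr] fix_hr by (simp add: r_def)
  then have "act n w (hr_image C D) = refl n p hr"
    unfolding refl_p_hr by (auto simp: fun_eq_iff algebra_simps)
  then have hr_image': "hr_image C' D = refl n p hr" using C'(2) by (simp add: hr_image_def)
  obtain E where E: "E \<in> Ch" "\<delta> E C' = refl n p" "\<delta> E D = refl n p \<circ> \<delta> C' D"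
    using delta_exists[OF C'Ch D p_range] .
  have "\<delta> E D hr = hr" using E(3) hr_image' p_range by (simp add: hr_image_def)
  then have "\<delta> E D \<in> Wsub n J" using stabilizer_hr delta_W E(1) D by blast
  then have "E \<in> resJ D" using resJ_sym[OF E(1)] D by (simp add: res_def)
  moreover have "\<delta> C' E = refl n p" using adjacent_sym[OF E(1) C'Ch p_range E(2)] .
  ultimately show "collinear n \<delta> (resJ C) (resJ D)" using C'(1) by (auto simp: collinear_def)
qed

section \<open>Recognising the positions 1 and 2'\<close>

lemma resJ_neq: "C \<in> Ch \<Longrightarrow> D \<in> Ch \<Longrightarrow> hr_image C D p \<noteq> 2 \<Longrightarrow> resJ C \<noteq> resJ D"
  using hr_image_self resJ_self by blast

lemma pos1I:
  assumes "C \<in> Ch" "D \<in> Ch" "hr_image C D p = 1"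
  shows "pos1 n \<delta> (resJ C) (resJ D)"
  using assms collinear_iff resJ_neq by (simp add: pos1_def)

text \<open>The step lowers the coordinate at \<open>p\<close> by 2, so the root of \<open>E\<close>
  has product 2 with \<open>alpha p\<close> and equals it.\<close>

lemma between_step:
  assumes "C \<in> Ch" "D \<in> Ch" "E \<in> Ch" "\<delta> C E = refl n p" "hr_image C D p = -1" "hr_image E D p = 1"
  shows "hr_image E D = alpha p" "hr_image C D = (\<lambda>k. - alpha p k)"
proof -
  have step: "hr_image C D = refl n p (hr_image E D)"
    using hr_image_step[OF assms(3,2,1) p_range assms(4)] assms(5,6) by auto
  then have "B n (hr_image E D) (alpha p) = 2"
    using assms(5,6) p_range by (simp add: refl_eq)
  then show "hr_image E D = alpha p"
    using hr_image_root[OF assms(3,2)] pos_root_alpha[OF p_range]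
    by (intro root_product_2) (simp_all add: pos_root_def)
  then show "hr_image C D = (\<lambda>k. - alpha p k)"
    using step p_range by (simp add: refl_eq B_alpha_alpha)
qed

text \<open>Distinct \<open>E\<close> and \<open>F\<close> would be adjacent of type
  \<open>p\<close>, being in one panel. Since \<open>alpha p\<close> has positive product with
  itself, the step from \<open>F\<close> to \<open>E\<close> would have to turn
  \<open>alpha p\<close> into its negative.\<close>

lemma between_unique:
  assumes "C \<in> Ch" "D \<in> Ch" "E \<in> Ch" "F \<in> Ch" "\<delta> E C = refl n p" "\<delta> F C = refl n p"
    and "hr_image E D = alpha p" "hr_image F D = alpha p"
  shows "E = F"
proof (rule ccontr)
  assume "E \<noteq> F"
  have "\<delta> C F = refl n p" using adjacent_sym assms(1,4,6) p_range by blast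
  then have "\<delta> E F = refl n p \<circ> refl n p \<or> \<delta> E F = refl n p"
    using delta_step(1)[OF assms(1,4,3) p_range assms(5)] by simp
  then have "\<delta> E F = refl n p" using \<open>E \<noteq> F\<close> delta_id[OF assms(3,4)] p_range by simp
  then have "hr_image E D = refl n p (hr_image F D)"
    using hr_image_step_pos[OF assms(4,2,3) p_range] assms(8) p_range by (simp add: B_alpha_alpha)
  then have "alpha p = (\<lambda>k. - alpha p k)" using assms(7,8) p_range by (simp add: refl_eq B_alpha_alpha)
  from fun_cong[OF this, of p] show False by simp
qed

text \<open>For \<open>hr_image C D p = -1\<close>, a common neighbour is reached through a chamber of the point of \<open>C\<close>
  with \<open>hr_image\<close>-value \<open>- alpha p\<close>. Any two such chambers are joined by a gallery with types in the
  stabilizer of \<open>alpha p\<close>, and these types commute with the step to the neighbour.\<close>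

abbreviation J0 :: "nat set" where
  "J0 \<equiv> {j \<in> J. B n (\<lambda>k. - alpha p k) (alpha j) = 0}"

text \<open>The reflections at \<open>k\<close> and \<open>p\<close> commute, so the chambers
  \<open>C'\<close>, \<open>C\<close>, \<open>E\<close> complete to a rectangle whose fourth corner
  \<open>G\<close> is \<open>k\<close>-adjacent to \<open>E\<close> and \<open>p\<close>-adjacent to
  \<open>C'\<close>. The root \<open>alpha p\<close> is fixed by the reflection at
  \<open>k\<close>.\<close>

lemma between_transport:
  assumes C: "C \<in> Ch" "D \<in> Ch" "E \<in> Ch" "C' \<in> Ch"
    and k: "k \<in> J0" and adj: "\<delta> C' C = refl n k" "\<delta> E C = refl n p" and rE: "hr_image E D = alpha p"
  shows "\<exists>G\<in>resJ E. \<delta> G C' = refl n p \<and> hr_image G D = alpha p"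
proof -
  have k1: "k \<in> {1..n}" "k \<in> J" and orth: "B n (alpha p) (alpha k) = 0" using k by (auto simp: B_uminus)
  have comm: "refl n k \<circ> refl n p = refl n p \<circ> refl n k"
  proof
    fix v
    show "(refl n k \<circ> refl n p) v = (refl n p \<circ> refl n k) v"
      using k1(1) p_range orth B_scale(1)[of n _ "alpha p"] B_scale(1)[of n _ "alpha k"]
      by (simp add: refl_eq B_diff B_sym[of n "alpha k" "alpha p"] diff_right_commute)
  qed
  have pC: "\<delta> C E = refl n p" using adjacent_sym C adj(2) p_range by blast
  have "inv (refl n p) = refl n p" by (intro inv_unique_comp refl_comp p_range)
  moreover have "refl n p (alpha k) = alpha k"
    using p_range orth by (simp add: refl_eq B_sym[of n "alpha k"])
  ultimately have "pos_root n (inv (\<delta> C E) (alpha k))" using pC pos_root_alpha[OF k1(1)] by simp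
  then have "len n (refl n k \<circ> \<delta> C E) = len n (\<delta> C E) + 1"
    using len_up delta_W C(1,3) k1(1) by blast
  then have "\<delta> C' E = refl n k \<circ> refl n p"
    using delta_step(2)[OF C(1,3,4) k1(1) adj(1)] pC by simp
  then have "\<delta> E C' = inv (refl n k \<circ> refl n p)" using delta_inv[OF C(4,3)] by simp
  also have "\<dots> = refl n k \<circ> refl n p"
  proof (rule inv_unique_comp)
    have "refl n k \<circ> refl n p \<circ> (refl n k \<circ> refl n p)
        = refl n k \<circ> (refl n p \<circ> refl n k) \<circ> refl n p" by (simp only: comp_assoc)
    also have "\<dots> = (refl n k \<circ> refl n k) \<circ> (refl n p \<circ> refl n p)"
      by (simp only: comm[symmetric] comp_assoc)
    also have "\<dots> = id" using k1(1) p_range by simp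
    finally show "refl n k \<circ> refl n p \<circ> (refl n k \<circ> refl n p) = id" .
    then show "refl n k \<circ> refl n p \<circ> (refl n k \<circ> refl n p) = id" .
  qed
  finally have EC': "\<delta> E C' = refl n k \<circ> refl n p" .
  obtain G where G: "G \<in> Ch" "\<delta> G E = refl n k" "\<delta> G C' = refl n k \<circ> \<delta> E C'"
    using delta_exists[OF C(3,4) k1(1)] .
  have "\<delta> G C' = refl n p" using G(3) EC' k1(1) by (simp add: comp_assoc[symmetric])
  moreover have "hr_image G D = alpha p"
    using hr_image_step[OF C(3,2) G(1) k1(1) G(2)] rE k1(1) orth by (simp add: refl_eq)
  moreover have "G \<in> resJ E" using resJ_adjacent[OF C(3) G(1) k1(2)] adjacent_sym[OF G(1) C(3) k1(1) G(2)] by blast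
  ultimately show ?thesis by blast
qed

lemma between_gallery:
  assumes "C \<in> Ch" "D \<in> Ch" "E \<in> Ch" "\<delta> E C = refl n p" "hr_image E D = alpha p"
  shows "C' \<in> Ch \<Longrightarrow> set w \<subseteq> J0 \<Longrightarrow> gallery w C' C \<Longrightarrow>
    \<exists>G\<in>resJ E. \<delta> G C' = refl n p \<and> hr_image G D = alpha p"
proof (induction w arbitrary: C')
  case Nil
  then show ?case using resJ_self assms by auto
next
  case (Cons k w)
  then obtain C2 where C2: "C2 \<in> Ch" "\<delta> C' C2 = refl n k" "gallery w C2 C" by auto
  then obtain G where G: "G \<in> resJ E" "\<delta> G C2 = refl n p" "hr_image G D = alpha p"
    using Cons.IH[OF C2(1)] Cons.prems(2) by auto
  have "k \<in> J0" using Cons.prems(2) by simp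
  from between_transport[OF C2(1) assms(2) resJ_Ch[OF G(1)] Cons.prems(1) this C2(2) G(2,3)]
  obtain H where "H \<in> resJ G" "\<delta> H C' = refl n p" "hr_image H D = alpha p" by blast
  then show ?case using resJ_trans[OF assms(3) G(1)] by blast
qed

text \<open>Starting from a \<open>J\<close>-dominant root, every step along a reduced word meets a
  nonnegative product, so none of the steps is ambiguous.\<close>

lemma hr_image_gallery:
  assumes D: "D \<in> Ch" and C: "C \<in> Ch" and dom: "\<And>j. j \<in> J \<Longrightarrow> 0 \<le> B n (hr_image C D) (alpha j)"
  shows "C' \<in> Ch \<Longrightarrow> reduced J w \<Longrightarrow> gallery w C' C \<Longrightarrow> hr_image C' D = act n w (hr_image C D)"
proof (induction w arbitrary: C')
  case Nil
  then show ?case by simp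
next
  case (Cons j w)
  then obtain C2 where C2: "C2 \<in> Ch" "\<delta> C' C2 = refl n j" "gallery w C2 C" by auto
  have j: "j \<in> {1..n}" using Cons.prems(2) by (auto simp: reduced_def)
  have IH: "hr_image C2 D = act n w (hr_image C D)" using Cons C2 reduced_tl by blast
  have "0 \<le> B n (act n w (hr_image C D)) (alpha j)"
    by (rule reduced_dominant_step[OF J_subset Cons.prems(2) dom])
  then have "hr_image C' D = refl n j (hr_image C2 D)"
    using hr_image_step_pos[OF C2(1) D Cons.prems(1) j C2(2)] IH by simp
  then show ?case using IH by simp
qed

text \<open>Each common neighbour is \<open>p\<close>-adjacent to a foot in the point of
  \<open>C\<close> whose root is \<open>- alpha p\<close>. A reduced \<open>J\<close>-gallery
  between two feet fixes this dominant root, so its types lie in \<open>J0\<close>. Transport along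
  it brings the first neighbour to the second foot, where the panel contains only one
  candidate.\<close>

lemma common_neighbour_unique:
  assumes C: "C \<in> Ch" "D \<in> Ch" "hr_image C D p = -1"
    and E: "E \<in> Ch" "collinear n \<delta> (resJ C) (resJ E)" "collinear n \<delta> (resJ E) (resJ D)"
    and F: "F \<in> Ch" "collinear n \<delta> (resJ C) (resJ F)" "collinear n \<delta> (resJ F) (resJ D)"
  shows "resJ E = resJ F"
proof -
  have foot: "\<exists>C1\<in>resJ C. \<exists>E1\<in>resJ E. \<delta> E1 C1 = refl n p \<and> hr_image E1 D = alpha p \<and> hr_image C1 D = (\<lambda>k. - alpha p k)"
    if E: "E \<in> Ch" "collinear n \<delta> (resJ C) (resJ E)" "collinear n \<delta> (resJ E) (resJ D)" for E
  proof -
    obtain C1 E1 where C1: "C1 \<in> resJ C" and E1: "E1 \<in> resJ E" and adj: "\<delta> C1 E1 = refl n p"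
      using E(2) by (auto simp: collinear_def)
    have Ch: "C1 \<in> Ch" "E1 \<in> Ch" using C1 E1 by (simp_all add: resJ_Ch)
    have "hr_image E1 D p = 1" using hr_image_left_p[OF E(1) C(2) E1] collinear_iff[OF E(1) C(2)] E(3) by simp
    moreover have "hr_image C1 D p = -1" using hr_image_left_p[OF C(1,2) C1] C(3) by simp
    ultimately show ?thesis
      using between_step[OF Ch(1) C(2) Ch(2) adj] adjacent_sym[OF Ch p_range adj] C1 E1 by blast
  qed
  obtain C1 E1 where 1: "C1 \<in> resJ C" "E1 \<in> resJ E" "\<delta> E1 C1 = refl n p" "hr_image E1 D = alpha p"
    "hr_image C1 D = (\<lambda>k. - alpha p k)" using foot[OF E] by blast
  obtain C2 F2 where 2: "C2 \<in> resJ C" "F2 \<in> resJ F" "\<delta> F2 C2 = refl n p" "hr_image F2 D = alpha p"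
    "hr_image C2 D = (\<lambda>k. - alpha p k)" using foot[OF F] by blast
  have Ch: "C1 \<in> Ch" "E1 \<in> Ch" "C2 \<in> Ch" "F2 \<in> Ch" using 1 2 by (simp_all add: resJ_Ch)
  have dom: "0 \<le> B n (\<lambda>k. - alpha p k) (alpha j)" if "j \<in> J" for j
    using that p_range cartan_off[of p j] by (simp add: B_uminus B_alpha_alpha)
  have "C1 \<in> resJ C2" using resJ_eq[OF C(1) 2(1)] 1(1) by simp
  then have "\<delta> C2 C1 \<in> Wsub n J" by (simp add: res_def)
  then obtain w where w: "reduced J w" "act n w = \<delta> C2 C1" using reduced_exists by blast
  then have wJ: "set w \<subseteq> J" by (simp add: reduced_def)
  have gal: "gallery w C2 C1"
    using gallery_exists[OF Ch(3,1)] wJ J_subset w(2) by (metis subset_trans)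
  have "hr_image C2 D = act n w (hr_image C1 D)"
    by (rule hr_image_gallery[OF C(2) Ch(1) _ Ch(3) w(1) gal]) (simp only: 1(5) dom)
  then have "set w \<subseteq> J0"
    using 1(5) 2(5) by (intro reduced_stabilizer[OF J_subset w(1) dom]) simp_all
  then obtain G where G: "G \<in> resJ E1" "\<delta> G C2 = refl n p" "hr_image G D = alpha p"
    using between_gallery[OF Ch(1) C(2) Ch(2) 1(3,4) Ch(3) _ gal] by blast
  have "G = F2" by (rule between_unique[OF Ch(3) C(2) resJ_Ch[OF G(1)] Ch(4) G(2) 2(3) G(3) 2(4)])
  then show ?thesis using G(1) 1(2) 2(2) resJ_eq E(1) F(1) Ch(2) by metis
qed

text \<open>Moving inside the point of \<open>C\<close> produces the root \<open>- alpha p\<close>;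
  a step of type \<open>p\<close> turns it into \<open>alpha p\<close>, whose coordinate 1 at
  \<open>p\<close> means collinearity with the point of \<open>D\<close>.\<close>

lemma common_neighbour_exists:
  assumes C: "C \<in> Ch" "D \<in> Ch" "hr_image C D p = -1"
  shows "\<exists>E\<in>Ch. collinear n \<delta> (resJ C) (resJ E) \<and> collinear n \<delta> (resJ E) (resJ D)"
proof -
  obtain w where w: "set w \<subseteq> J" "act n w (hr_image C D) = (\<lambda>k. - alpha p k)"
    using J_raise[OF hr_image_root[OF C(1,2)] C(3)] by blast
  obtain C1 where C1: "C1 \<in> resJ C" "\<delta> C1 D = act n w \<circ> \<delta> C D"
    using resJ_move[OF C(1,2) w(1)] by blast
  have Ch: "C1 \<in> Ch" using C1(1) by (rule resJ_Ch)
  have r1: "hr_image C1 D = (\<lambda>k. - alpha p k)" using C1(2) w(2) by (simp add: hr_image_def)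
  obtain E where E: "E \<in> Ch" "\<delta> E C1 = refl n p" "\<delta> E D = refl n p \<circ> \<delta> C1 D"
    using delta_exists[OF Ch C(2) p_range] .
  have "hr_image E D = refl n p (\<lambda>k. - alpha p k)" using E(3) r1 by (simp add: hr_image_def)
  then have "hr_image E D = alpha p" using p_range by (simp add: refl_eq B_uminus B_alpha_alpha)
  then have "collinear n \<delta> (resJ E) (resJ D)" using collinear_iff[OF E(1) C(2)] by simp
  moreover have "\<delta> C1 E = refl n p" using adjacent_sym[OF E(1) Ch p_range E(2)] .
  then have "collinear n \<delta> (resJ C) (resJ E)"
    using C1(1) resJ_self[OF E(1)] by (auto simp: collinear_def)
  ultimately show ?thesis using E(1) by blast
qed

lemma pos2'I:
  assumes C: "C \<in> Ch" "D \<in> Ch" "hr_image C D p = -1"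
  shows "pos2' n Ch \<delta> (resJ C) (resJ D)"
  unfolding pos2'_def
proof (intro conjI)
  show "resJ C \<noteq> resJ D" using resJ_neq[OF C(1,2)] C(3) by simp
  show "\<not> collinear n \<delta> (resJ C) (resJ D)" using collinear_iff[OF C(1,2)] C(3) by simp
  obtain E where E: "E \<in> Ch" "collinear n \<delta> (resJ C) (resJ E)" "collinear n \<delta> (resJ E) (resJ D)"
    using common_neighbour_exists[OF C] by blast
  show "\<exists>!z. z \<in> points n Ch \<delta> \<and> z \<noteq> resJ C \<and> z \<noteq> resJ D \<and>
      collinear n \<delta> (resJ C) z \<and> collinear n \<delta> z (resJ D)"
  proof (rule ex1I[of _ "resJ E"])
    have "resJ E \<noteq> resJ C" using resJ_neq[OF C(1) E(1)] E(2) collinear_iff[OF C(1) E(1)] by auto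
    moreover have "resJ E \<noteq> resJ D" using resJ_neq[OF E(1) C(2)] E(3) collinear_iff[OF E(1) C(2)] by auto
    ultimately show "resJ E \<in> points n Ch \<delta> \<and> resJ E \<noteq> resJ C \<and> resJ E \<noteq> resJ D \<and>
        collinear n \<delta> (resJ C) (resJ E) \<and> collinear n \<delta> (resJ E) (resJ D)"
      using E by (simp add: points_def)
    fix z
    assume z: "z \<in> points n Ch \<delta> \<and> z \<noteq> resJ C \<and> z \<noteq> resJ D \<and>
      collinear n \<delta> (resJ C) z \<and> collinear n \<delta> z (resJ D)"
    then obtain F where "F \<in> Ch" "z = resJ F" by (auto simp: points_def)
    then show "z = resJ E" using common_neighbour_unique[OF C _ _ _ E] z by blast
  qed
qed

end

section \<open>Kangaroos\<close>

locale kangaroo = building_E n Ch \<delta> for n :: nat and Ch :: "'c set" and \<delta> +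
  fixes \<theta> :: "'c \<Rightarrow> 'c"
  assumes oppo: "oppomorphism n Ch \<delta> \<theta>"
    and kangaroo: "polar_kangaroo n Ch \<delta> \<theta>"
begin

lemma theta_bij: "bij_betw \<theta> Ch Ch"
  using oppo by (simp add: oppomorphism_def automorphism_def)

lemma theta_Ch: "C \<in> Ch \<Longrightarrow> \<theta> C \<in> Ch"
  using theta_bij by (auto simp: bij_betw_def)

lemma theta_adjacent:
  "C \<in> Ch \<Longrightarrow> D \<in> Ch \<Longrightarrow> i \<in> {1..n} \<Longrightarrow>
    \<delta> C D = refl n i \<longleftrightarrow> \<delta> (\<theta> C) (\<theta> D) = refl n (opp_type n i)"
  using oppo unfolding oppomorphism_def automorphism_def by blast

lemma opp_type_J:
  assumes j: "j \<in> J"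
  shows "opp_type n j \<in> J"
proof -
  have "opp_type n j \<noteq> p"
  proof
    assume "opp_type n j = p"
    then have "opp_type n (opp_type n j) = p" by (simp only: opp_type_p)
    then show False using j by (simp add: opp_type_opp_type)
  qed
  then show ?thesis using opp_type_range[of j] j by simp
qed

lemma opp_type_map_J: "set w \<subseteq> J \<Longrightarrow> set (map (opp_type n) w) \<subseteq> J"
proof
  fix i assume "set w \<subseteq> J" "i \<in> set (map (opp_type n) w)"
  then obtain j where "j \<in> J" "i = opp_type n j" unfolding set_map by blast
  then show "i \<in> J" by (simp only: opp_type_J)
qed

lemma theta_gallery:
  assumes "D \<in> Ch"
  shows "C \<in> Ch \<Longrightarrow> set w \<subseteq> {1..n} \<Longrightarrow>
    gallery w C D \<longleftrightarrow> gallery (map (opp_type n) w) (\<theta> C) (\<theta> D)"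
proof (induction w arbitrary: C)
  case Nil
  then show ?case using theta_bij assms by (auto simp: bij_betw_def inj_on_def)
next
  case (Cons i w)
  then have i: "i \<in> {1..n}" by simp
  have "gallery (i # w) C D \<longleftrightarrow> (\<exists>E\<in>Ch. \<delta> (\<theta> C) (\<theta> E) = refl n (opp_type n i)
      \<and> gallery (map (opp_type n) w) (\<theta> E) (\<theta> D))"
    using Cons theta_adjacent[OF Cons.prems(1) _ i] by auto
  also have "\<dots> \<longleftrightarrow> (\<exists>E\<in>\<theta> ` Ch. \<delta> (\<theta> C) E = refl n (opp_type n i)
      \<and> gallery (map (opp_type n) w) E (\<theta> D))" by blast
  also have "\<theta> ` Ch = Ch" using theta_bij by (simp add: bij_betw_def)
  finally show ?case by simp
qed

text \<open>The automorphism is given by its effect on adjacency, so its effect on points is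
  obtained through galleries; \<open>opp_type\<close> preserves \<open>J\<close> because it fixes
  \<open>p\<close>.\<close>

lemma theta_resJ:
  assumes C: "C \<in> Ch"
  shows "\<theta> ` resJ C = resJ (\<theta> C)"
proof (intro set_eqI iffI)
  fix X assume "X \<in> \<theta> ` resJ C"
  then obtain D w where D: "X = \<theta> D" "D \<in> Ch" "set w \<subseteq> J" "gallery w C D"
    using resJ_gallery[OF C] by auto
  then have "gallery (map (opp_type n) w) (\<theta> C) (\<theta> D)"
    using theta_gallery[OF D(2) C] by (meson J_subset subset_trans)
  moreover have "set (map (opp_type n) w) \<subseteq> J" using D(3) by (rule opp_type_map_J)
  ultimately show "X \<in> resJ (\<theta> C)"
    using resJ_gallery[OF theta_Ch[OF C]] D(1) theta_Ch[OF D(2)] by blast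
next
  fix X assume "X \<in> resJ (\<theta> C)"
  then obtain w where w: "X \<in> Ch" "set w \<subseteq> J" "gallery w (\<theta> C) X"
    using resJ_gallery[OF theta_Ch[OF C]] by auto
  obtain D where D: "D \<in> Ch" "X = \<theta> D" using theta_bij w(1) by (auto simp: bij_betw_def)
  have v: "set (map (opp_type n) w) \<subseteq> J" using w(2) by (rule opp_type_map_J)
  have "map (opp_type n) (map (opp_type n) w) = w" by (simp add: comp_def opp_type_opp_type)
  then have "gallery (map (opp_type n) w) C D"
    using theta_gallery[OF D(1) C, of "map (opp_type n) w"] w(3) D(2) v J_subset by (metis subset_trans)
  then have "D \<in> resJ C" using resJ_gallery[OF C] D(1) v by blast
  then show "X \<in> \<theta> ` resJ C" using D(2) by blast
qed

text \<open>Here the geometric kangaroo condition becomes a condition on one coordinate of a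
  root.\<close>

lemma displacement_p:
  assumes C: "C \<in> Ch"
  shows "hr_image C (\<theta> C) p \<noteq> 1 \<and> hr_image C (\<theta> C) p \<noteq> -1"
proof -
  have "resJ C \<in> points n Ch \<delta>" using C by (simp add: points_def)
  then have "\<not> pos1 n \<delta> (resJ C) (resJ (\<theta> C))" "\<not> pos2' n Ch \<delta> (resJ C) (resJ (\<theta> C))"
    using kangaroo unfolding polar_kangaroo_def theta_resJ[OF C, symmetric] by blast+
  then show ?thesis using pos1I pos2'I C theta_Ch by blast
qed

text \<open>Passing from \<open>C\<close> to \<open>C'\<close> moves both arguments of the
  displacement; this isolates the move of the second one.\<close>

lemma displacement_step:
  assumes "C \<in> Ch" "C' \<in> Ch" "i \<in> {1..n}" "\<delta> C' C = refl n i"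
  shows "\<delta> C' (\<theta> C') = \<delta> C' (\<theta> C) \<circ> refl n (opp_type n i) \<or> \<delta> C' (\<theta> C') = \<delta> C' (\<theta> C)"
proof (rule delta_step_right)
  have "\<delta> C C' = refl n i" using adjacent_sym[OF assms(2,1,3,4)] .
  then show "\<delta> (\<theta> C) (\<theta> C') = refl n (opp_type n i)"
    using theta_adjacent[OF assms(1,2,3)] by simp
qed (use assms theta_Ch opp_type_range in simp_all)

text \<open>At each node \<open>a\<close> the first argument is moved so that
  \<open>refl n a\<close> is multiplied on the left. The image then either stays or contributes a
  factor on the right, which \<open>comm\<close> carries through \<open>f\<close> to give a
  conjugation. Both outcomes are covered by \<open>lowers_Cons\<close>.\<close>

lemma walk_along_path:
  assumes comm: "\<And>i. i \<in> {1..n} \<Longrightarrow> f \<circ> refl n (opp_type n i) = refl n i \<circ> f"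
    and C: "C \<in> Ch" "\<delta> C (\<theta> C) = refl n i \<circ> f"
  shows "induced_path l \<Longrightarrow> set l \<subseteq> {1..n} \<Longrightarrow> last l = i \<Longrightarrow>
    \<exists>C'\<in>Ch. \<exists>u. lowers l u \<and> \<delta> C' (\<theta> C') = u \<circ> f"
proof (induction l rule: induced_path.induct)
  case 1
  then show ?case by simp
next
  case (2 a)
  then have "lowers [a] (refl n i)" using lowers_refl[of i] by simp
  then show ?case using C by blast
next
  case (3 a b l)
  then have a: "a \<in> {1..n}" by simp
  obtain C' u where C': "C' \<in> Ch" "lowers (b # l) u" "\<delta> C' (\<theta> C') = u \<circ> f"
    using 3 by (auto simp del: comp_apply)
  obtain E where E: "E \<in> Ch" "\<delta> E C' = refl n a" "\<delta> E (\<theta> C') = refl n a \<circ> \<delta> C' (\<theta> C')"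
    using delta_exists[OF C'(1) theta_Ch[OF C'(1)] a] .
  have "(refl n a \<circ> (u \<circ> f)) \<circ> refl n (opp_type n a) = (refl n a \<circ> u \<circ> refl n a) \<circ> f"
    by (simp only: comp_assoc comm[OF a])
  then have "\<delta> E (\<theta> E) = (refl n a \<circ> u \<circ> refl n a) \<circ> f \<or> \<delta> E (\<theta> E) = (refl n a \<circ> u) \<circ> f"
    using displacement_step[OF C'(1) E(1) a E(2)] unfolding E(3) C'(3) by (simp only: comp_assoc)
  moreover have "lowers (a # b # l) (refl n a \<circ> u)" "lowers (a # b # l) (refl n a \<circ> u \<circ> refl n a)"
    using lowers_Cons[OF C'(2) 3(2,3)] by simp_all
  ultimately show ?case using E(1) by blast
qed

lemma displacement_constant:
  assumes f: "f \<in> W n" and comm: "\<And>i. i \<in> {1..n} \<Longrightarrow> f \<circ> refl n (opp_type n i) = refl n i \<circ> f"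
    and hr: "f hr = hr \<or> f hr = (\<lambda>k. - hr k)"
    and C0: "C0 \<in> Ch" "\<delta> C0 (\<theta> C0) = f" and C: "C \<in> Ch"
  shows "\<delta> C (\<theta> C) = f"
proof -
  have no_step: "\<delta> C (\<theta> C) \<noteq> refl n i \<circ> f" if C: "C \<in> Ch" and i: "i \<in> {1..n}" for C i
  proof
    assume "\<delta> C (\<theta> C) = refl n i \<circ> f"
    moreover obtain l where l: "induced_path l" "hd l = p" "last l = i" "set l \<subseteq> {1..n}"
      using path_from_p[OF i] by blast
    ultimately obtain C' u where C': "C' \<in> Ch" "lowers l u" "\<delta> C' (\<theta> C') = u \<circ> f"
      using walk_along_path[OF comm C _ l(1,4,3)] by blast
    have u: "u \<in> W n" using C'(2) Wsub_mono[OF l(4)] unfolding lowers_def by blast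
    have tl: "c \<noteq> p" if "c \<in> set (tl l)" for c
      using l(1,2) that E_edge_irrefl by (cases l rule: induced_path.cases) auto
    have "B n hr (alpha c) = 0" if "c \<in> set (tl l)" for c
    proof -
      have "c \<in> {1..n}" using that l(4) by (cases l) auto
      then show ?thesis using tl[OF that] by (simp add: hr_alpha)
    qed
    then have "B n (u hr) hr = B n hr hr - 1"
      using C'(2) l(2) hr_alpha[OF p_range] by (simp add: lowers_def)
    then have "u hr p = 1" by (simp add: B_sym[of n "u hr"] B_hr hr_p)
    moreover have "hr_image C' (\<theta> C') = u (f hr)" using C'(3) by (simp add: hr_image_def)
    ultimately have "hr_image C' (\<theta> C') p = 1 \<or> hr_image C' (\<theta> C') p = -1"
      using hr W_uminus[OF u, of hr] by auto
    then show False using displacement_p[OF C'(1)] by blast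
  qed
  have "gallery w C0 C \<Longrightarrow> set w \<subseteq> {1..n} \<Longrightarrow> C0 \<in> Ch \<Longrightarrow> \<delta> C0 (\<theta> C0) = f \<Longrightarrow> \<delta> C (\<theta> C) = f" for w C0
  proof (induction w arbitrary: C0)
    case Nil
    then show ?case by simp
  next
    case (Cons i w)
    then have i: "i \<in> {1..n}" by simp
    obtain E where E: "E \<in> Ch" "\<delta> C0 E = refl n i" "gallery w E C" using Cons.prems(1) by auto
    have adj: "\<delta> E C0 = refl n i" using adjacent_sym[OF Cons.prems(3) E(1) i E(2)] .
    have "refl n i \<circ> f \<circ> refl n (opp_type n i) = (refl n i \<circ> refl n i) \<circ> f"
      by (simp only: comp_assoc comm[OF i])
    also have "\<dots> = f" using i by simp
    finally have conj: "refl n i \<circ> f \<circ> refl n (opp_type n i) = f" .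
    have "\<delta> E (\<theta> C0) = refl n i \<circ> f \<or> \<delta> E (\<theta> C0) = f"
      using delta_step(1)[OF Cons.prems(3) theta_Ch[OF Cons.prems(3)] E(1) i adj]
      unfolding Cons.prems(4) .
    \<comment> \<open>Of the four combinations of left and right factors, conjugation or none gives
      \<open>f\<close>, and a single factor on either side gives
      \<open>refl n i \<circ> f\<close>.\<close>
    then have "\<delta> E (\<theta> E) = f \<or> \<delta> E (\<theta> E) = refl n i \<circ> f"
      using displacement_step[OF Cons.prems(3) E(1) i adj] conj comm[OF i] by metis
    then have "\<delta> E (\<theta> E) = f" using no_step[OF E(1) i] by blast
    then show ?case using Cons E by simp
  qed
  moreover obtain w where w: "set w \<subseteq> {1..n}" "\<delta> C0 C = act n w"
    using delta_W[OF C0(1) C] by (auto simp: Wsub_def)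
  ultimately show ?thesis using gallery_exists[OF C0(1) C w] C0 by blast
qed

text \<open>One chamber mapped to an opposite one has a longest element as displacement, which
  satisfies the conditions of \<open>displacement_constant\<close> by
  \<open>longest\<close>.\<close>

lemma anisotropic_or_domestic: "anisotropic n Ch \<delta> \<theta> \<or> domestic n Ch \<delta> \<theta>"
proof (rule disjCI)
  assume "\<not> domestic n Ch \<delta> \<theta>"
  then obtain C0 where C0: "C0 \<in> Ch" "opposite n \<delta> C0 (\<theta> C0)" by (auto simp: domestic_def)
  define f where "f = \<delta> C0 (\<theta> C0)"
  have f: "f \<in> W n" using delta_W C0(1) theta_Ch by (simp add: f_def)
  have max: "\<forall>w\<in>W n. len n w \<le> len n f" using C0(2) by (simp add: opposite_def f_def)
  have "\<delta> C (\<theta> C) = f" if "C \<in> Ch" for C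
    using displacement_constant[OF f longest(1)[OF f max] _ C0(1) f_def[symmetric] that]
      longest(2)[OF f max] by blast
  then show "anisotropic n Ch \<delta> \<theta>" using max by (simp add: anisotropic_def opposite_def)
qed

text \<open>The case \<open>f = id\<close> of \<open>displacement_constant\<close>: for
  \<open>n\<close> equal to 7 or 8 \<open>opp_type\<close> is the identity, so \<open>id\<close>
  intertwines as required.\<close>

lemma fixed_chamber_imp_trivial:
  assumes "n \<in> {7, 8}" "C0 \<in> Ch" "\<theta> C0 = C0" "C \<in> Ch"
  shows "\<theta> C = C"
proof -
  have "\<delta> C (\<theta> C) = id"
  proof (rule displacement_constant[OF Wsub_id _ _ assms(2) _ assms(4)])
    show "id \<circ> refl n (opp_type n i) = refl n i \<circ> id" for i
      using assms(1) by (auto simp: opp_type_def)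
    show "\<delta> C0 (\<theta> C0) = id" using delta_id assms(2,3) by simp
  qed simp
  then have "C = \<theta> C" using delta_id[OF assms(4) theta_Ch[OF assms(4)]] by blast
  then show ?thesis by (rule sym)
qed

end

theorem theorem3p2:
  fixes n :: nat and Ch :: "'c set" and \<delta> :: "'c \<Rightarrow> 'c \<Rightarrow> weyl" and \<theta> :: "'c \<Rightarrow> 'c"
  assumes "n \<in> {6, 7, 8}"
    and "thick_building n Ch \<delta>"
    and "oppomorphism n Ch \<delta> \<theta>"
    and "\<exists>C\<in>Ch. \<theta> C \<noteq> C"
    and "polar_kangaroo n Ch \<delta> \<theta>"
  shows "(n = 6 \<longrightarrow> anisotropic n Ch \<delta> \<theta> \<or> domestic n Ch \<delta> \<theta>) \<and>
         (n \<in> {7, 8} \<longrightarrow> anisotropic n Ch \<delta> \<theta> \<or>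
             (domestic n Ch \<delta> \<theta> \<and> (\<forall>C\<in>Ch. \<theta> C \<noteq> C)))"
proof -
  interpret kangaroo n Ch \<delta> \<theta>
    using assms(1,2,3,5) by unfold_locales
  have "\<forall>C\<in>Ch. \<theta> C \<noteq> C" if "n \<in> {7, 8}"
    using fixed_chamber_imp_trivial[OF that] assms(4) by blast
  then show ?thesis using anisotropic_or_domestic by blast
qed

end
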